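(* Let $X$ be a (real, Hausdorff) locally convex topological vector space, $\{f_t:t\in T\}$ ($T\ne\emptyset$) an arbitrary family of functions $f_t:X\to\overline{\mathbb{R}}$, $f:=\sup_{t\in T}f_t$, and let $D\subseteq\mathrm{dom}\,\overline{\mathrm{co}}f$ be a convex set such that $$\overline{\mathrm{co}}(f+\delta_D)(x)=\sup_{t\in T}\overline{\mathrm{co}}f_t(x)\quad\text{for all }x\in D.$$ Then for all $\bar x\in X$ $$\partial(f+\delta_D)(\bar x)=\bigcap_{\epsilon>0,\ L\in\mathcal{F}_{\bar x}}\mathrm{cl}^{w^*}\Big(\mathrm{co}\Big(\bigcup_{t\in T_\epsilon(\bar x)}\partial_\epsilon f_t(\bar x)\Big)+N_{D\cap L}(\bar x)\Big).$$
   Context: $\overline{\mathbb{R}}=\mathbb{R}\cup\{\pm\infty\}$ with the convention $(+\infty)+(-\infty)=+\infty$. $\overline{\mathrm{co}}g$ is the convex lower semicontinuous envelope of $g$; $\mathrm{dom}\,g=\{g<+\infty\}$; $\delta_D$ is the indicator function of $D$ ($0$ on $D$, $+\infty$ off $D$). $\mathcal{F}_{\bar x}$ is the set of finite-dimensional affine subspaces of $X$ containing $\bar x$. $T_\epsilon(\bar x):=\{t\in T:f(\bar x)\le f_t(\bar x)+\epsilon\}$. For $\epsilon\ge0$, $\partial_\epsilon g(x)=\{x^*\in X^*:\langle x^*,y-x\rangle\le g(y)-g(x)+\epsilon\ \forall y\in X\}$ if $g(x)\in\mathbb{R}$ and $\emptyset$ otherwise; $\partial=\partial_0$. For a convex set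 $C$, $N_C(x):=\partial\delta_C(x)=\{x^*\in X^*:\langle x^*,y-x\rangle\le0\ \forall y\in C\}$ if $x\in C$, and $N_C(x)=\emptyset$ if $x\notin C$. $\mathrm{cl}^{w^*}$ is the weak$^*$ closure in $X^*$, $\mathrm{co}$ the convex hull. *)

theory Defs
  imports "HOL-Analysis.Analysis"
begin

section \<open>Hausdorff locally convex spaces\<close>

text \<open>In the last axiom convexity of \<open>V\<close> is spelled out because the constant \<^const>\<open>convex\<close>
  cannot be applied to the class parameter type; see \<open>ex_open_convex_subset\<close> below.\<close>

class locally_convex_space = real_vector + topological_ab_group_add + t2_space +
  assumes tendsto_scaleR_Pair:
    "LIM p (nhds (a :: real) \<times>\<^sub>F nhds x). fst p *\<^sub>R snd p :> nhds (a *\<^sub>R x)"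
  and ex_open_convex_subset_raw:
    "open U \<Longrightarrow> 0 \<in> U \<Longrightarrow> \<exists>V. open V \<and>
      (\<forall>x\<in>V. \<forall>y\<in>V. \<forall>u\<ge>0. \<forall>v\<ge>0. u + v = 1 \<longrightarrow> u *\<^sub>R x + v *\<^sub>R y \<in> V) \<and> 0 \<in> V \<and> V \<subseteq> U"

lemma ex_open_convex_subset:
  fixes U :: "'a::locally_convex_space set"
  assumes "open U" "0 \<in> U"
  shows "\<exists>V. open V \<and> convex V \<and> 0 \<in> V \<and> V \<subseteq> U"
  using ex_open_convex_subset_raw[OF assms] unfolding convex_def .

instance real_normed_vector \<subseteq> locally_convex_space
proof
  fix a :: real and x :: 'a
  show "LIM p (nhds a \<times>\<^sub>F nhds x). fst p *\<^sub>R snd p :> nhds (a *\<^sub>R x)"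
    by (intro tendsto_scaleR filterlim_fst filterlim_snd)
next
  fix U :: "'a set"
  assume "open U" "0 \<in> U"
  then obtain e where "e > 0" "ball 0 e \<subseteq> U"
    using open_contains_ball by blast
  then show "\<exists>V. open V \<and>
      (\<forall>x\<in>V. \<forall>y\<in>V. \<forall>u\<ge>0. \<forall>v\<ge>0. u + v = 1 \<longrightarrow> u *\<^sub>R x + v *\<^sub>R y \<in> V) \<and> 0 \<in> V \<and> V \<subseteq> U"
    using convex_ball[of 0 e] unfolding convex_def by (intro exI[of _ "ball 0 e"]) auto
qed


section \<open>The topological dual with its weak* topology\<close>

typedef (overloaded) ('a::"{real_vector, topological_space}") dual =
  "{\<phi> :: 'a \<Rightarrow> real. linear \<phi> \<and> continuous_on UNIV \<phi>}"
  morphisms dual_apply Dual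
  by (rule exI[of _ "\<lambda>_. 0"]) (auto simp: linear_iff)

setup_lifting type_definition_dual

instantiation dual :: ("{real_vector, topological_space}") real_vector
begin

lift_definition zero_dual :: "'a dual" is "\<lambda>_. 0"
  by (auto simp: linear_iff)

lift_definition plus_dual :: "'a dual \<Rightarrow> 'a dual \<Rightarrow> 'a dual" is "\<lambda>\<phi> \<psi> x. \<phi> x + \<psi> x"
  by (auto intro: linear_compose_add continuous_on_add)

lift_definition minus_dual :: "'a dual \<Rightarrow> 'a dual \<Rightarrow> 'a dual" is "\<lambda>\<phi> \<psi> x. \<phi> x - \<psi> x"
  by (auto intro: linear_compose_sub continuous_on_diff)

lift_definition uminus_dual :: "'a dual \<Rightarrow> 'a dual" is "\<lambda>\<phi> x. - \<phi> x"
  by (auto intro: linear_compose_neg continuous_on_minus)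

lift_definition scaleR_dual :: "real \<Rightarrow> 'a dual \<Rightarrow> 'a dual" is "\<lambda>c \<phi> x. c * \<phi> x"
  by (auto simp: linear_iff algebra_simps intro: continuous_on_mult_left)

instance
  by standard (transfer; auto simp: algebra_simps)+

end

text \<open>The type \<open>'a dual\<close> carries the weak* topology: the initial topology for the evaluation maps,
  i.e. the pullback of the product topology on \<open>'a \<Rightarrow> real\<close>. Hence \<^const>\<open>closure\<close> on
  \<open>'a dual\<close> is the weak* closure.\<close>

instantiation dual :: ("{real_vector, topological_space}") topological_space
begin

definition open_dual :: "'a dual set \<Rightarrow> bool"
  where "open_dual U \<longleftrightarrow> (\<exists>V. open V \<and> U = dual_apply -` V)"

instance
proof
  show "open (UNIV :: 'a dual set)"
    unfolding open_dual_def by (rule exI[of _ UNIV]) auto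
next
  fix S T :: "'a dual set"
  assume "open S" "open T"
  then show "open (S \<inter> T)"
    unfolding open_dual_def by (metis open_Int vimage_Int)
next
  fix K :: "'a dual set set"
  assume "\<forall>S\<in>K. open S"
  then obtain V where V: "\<And>S. S \<in> K \<Longrightarrow> open (V S) \<and> S = dual_apply -` V S"
    unfolding open_dual_def by metis
  then have "\<Union>K = dual_apply -` (\<Union>S\<in>K. V S)"
    by (auto simp: vimage_def)
  moreover have "open (\<Union>S\<in>K. V S)"
    using V by (intro open_UN) blast
  ultimately show "open (\<Union>K)"
    unfolding open_dual_def by blast
qed

end


section \<open>Extended-real-valued functions\<close>

text \<open>Addition on \<^typ>\<open>ereal\<close> satisfies \<open>\<infinity> + (-\<infinity>) = \<infinity>\<close>, which is the convention wanted here.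
  Convexity of a function with values in \<^typ>\<open>ereal\<close> is convexity of its epigraph, a subset of
  \<open>X \<times> \<real>\<close>; the constants \<^const>\<open>convex_on\<close> and \<^const>\<open>epigraph\<close> only cover real values.\<close>

definition convex_fun :: "('a::real_vector \<Rightarrow> ereal) \<Rightarrow> bool"
  where "convex_fun g \<longleftrightarrow> convex {(x, r :: real). g x \<le> ereal r}"

definition lsc_fun :: "('a::topological_space \<Rightarrow> ereal) \<Rightarrow> bool"
  where "lsc_fun g \<longleftrightarrow> (\<forall>c. closed {x. g x \<le> c})"

text \<open>The largest convex lower semicontinuous minorant; the value \<open>-\<infinity>\<close> is allowed, for the
  minorants as well as for the envelope.\<close>

definition convex_lsc_envelope ::
    "('a::{real_vector, topological_space} \<Rightarrow> ereal) \<Rightarrow> 'a \<Rightarrow> ereal"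
  where "convex_lsc_envelope g x = (SUP h \<in> {h. convex_fun h \<and> lsc_fun h \<and> h \<le> g}. h x)"

definition effective_dom :: "('a \<Rightarrow> ereal) \<Rightarrow> 'a set"
  where "effective_dom g = {x. g x < \<infinity>}"

definition indicator_fun :: "'a set \<Rightarrow> 'a \<Rightarrow> ereal"
  where "indicator_fun D x = (if x \<in> D then 0 else \<infinity>)"

definition sup_fun :: "'i set \<Rightarrow> ('i \<Rightarrow> 'a \<Rightarrow> ereal) \<Rightarrow> 'a \<Rightarrow> ereal"
  where "sup_fun T f x = (SUP t\<in>T. f t x)"

definition eps_active :: "'i set \<Rightarrow> ('i \<Rightarrow> 'a \<Rightarrow> ereal) \<Rightarrow> real \<Rightarrow> 'a \<Rightarrow> 'i set"
  where "eps_active T f \<epsilon> x = {t \<in> T. sup_fun T f x \<le> f t x + ereal \<epsilon>}"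


section \<open>Subdifferentials and normal cones\<close>

definition eps_subdifferential ::
    "real \<Rightarrow> ('a::{real_vector, topological_space} \<Rightarrow> ereal) \<Rightarrow> 'a \<Rightarrow> 'a dual set"
  where "eps_subdifferential \<epsilon> g x =
    (if \<bar>g x\<bar> \<noteq> \<infinity>
     then {\<phi>. \<forall>y. ereal (dual_apply \<phi> (y - x)) \<le> g y - g x + ereal \<epsilon>}
     else {})"

abbreviation subdifferential ::
    "('a::{real_vector, topological_space} \<Rightarrow> ereal) \<Rightarrow> 'a \<Rightarrow> 'a dual set"
  where "subdifferential \<equiv> eps_subdifferential 0"

definition normal_cone ::
    "'a::{real_vector, topological_space} set \<Rightarrow> 'a \<Rightarrow> 'a dual set"
  where "normal_cone C x = subdifferential (indicator_fun C) x"

lemma normal_cone_eq: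
  "normal_cone C x = (if x \<in> C then {\<phi>. \<forall>y\<in>C. dual_apply \<phi> (y - x) \<le> 0} else {})"
  by (auto simp: normal_cone_def eps_subdifferential_def indicator_fun_def zero_ereal_def)

definition fin_dim_affine_through :: "'a::real_vector \<Rightarrow> 'a set set"
  where "fin_dim_affine_through x = {L. affine L \<and> x \<in> L \<and> (\<exists>B. finite B \<and> L = affine hull B)}"

end

theory Submission
  imports Defs
begin

text \<open>Write \<open>h\<^sub>t\<close> for the envelope of \<open>f\<^sub>t\<close>. A subgradient \<open>\<phi>\<close> of \<open>f + \<delta>\<^sub>D\<close> at \<open>x\<close> gives an affine
  minorant of the envelope of \<open>f + \<delta>\<^sub>D\<close>, hence of \<open>sup h\<^sub>t\<close> on \<open>D\<close>, which is exact at \<open>x\<close>. If \<open>\<phi>\<close> were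
  not in the weak* closure, it could be separated by a vector \<open>v\<close> in the polar of the normal cone
  of \<open>D \<inter> L\<close>. As \<open>D \<inter> L\<close> is finite-dimensional, a small perturbation makes \<open>v\<close> feasible for
  \<open>D\<close> at \<open>x\<close>. The formula \<open>inf\<^sub>s (h\<^sub>t (x + s v) - h\<^sub>t x + \<epsilon>) / s\<close> for the support function of
  \<open>\<partial>\<^sub>\<epsilon> h\<^sub>t x\<close> then bounds every almost active \<open>h\<^sub>t\<close> at some point of the ray, the other \<open>h\<^sub>t\<close> are
  small at \<open>x\<close> itself, and by convexity all of them lie, at one common point of the ray close to
  \<open>x\<close>, strictly below the affine minorant. The other inclusion is a direct computation with
  \<open>L\<close> the line through \<open>x\<close> and \<open>y\<close>.\<close>

section \<open>Algebraic separation\<close>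

text \<open>Homogeneity is demanded only as an inequality for positive \<open>c\<close>, which is
  easy to check for infima; applying it to \<open>inverse c\<close> recovers equality.\<close>

definition sublinear :: "('a::real_vector \<Rightarrow> real) \<Rightarrow> bool"
  where "sublinear p \<longleftrightarrow>
    (\<forall>x y. p (x + y) \<le> p x + p y) \<and> (\<forall>c>0. \<forall>x. p (c *\<^sub>R x) \<le> c * p x)"

lemma sublinear_add: "sublinear p \<Longrightarrow> p (x + y) \<le> p x + p y"
  by (auto simp: sublinear_def)

lemma sublinear_scaleR_pos:
  assumes "sublinear p" "c > 0"
  shows "p (c *\<^sub>R x) = c * p x"
proof (rule antisym)
  show "p (c *\<^sub>R x) \<le> c * p x"
    using assms by (auto simp: sublinear_def)
  have "p (inverse c *\<^sub>R (c *\<^sub>R x)) \<le> inverse c * p (c *\<^sub>R x)"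
    using assms unfolding sublinear_def by (meson positive_imp_inverse_positive)
  then show "c * p x \<le> p (c *\<^sub>R x)"
    using assms(2) by (simp add: field_simps)
qed

lemma sublinear_zero:
  assumes "sublinear p" shows "p 0 = 0"
  using sublinear_scaleR_pos[OF assms, of 2 0] by simp

lemma sublinear_scaleR:
  assumes "sublinear p" "c \<ge> 0"
  shows "p (c *\<^sub>R x) = c * p x"
  using assms sublinear_scaleR_pos[of p c x] sublinear_zero[of p] by (cases "c = 0") auto

lemma sublinear_minus_le:
  assumes "sublinear p" shows "- p (- x) \<le> p x"
  using sublinear_add[OF assms, of x "- x"] sublinear_zero[OF assms] by simp

text \<open>For sublinear \<open>p\<close> this is the largest sublinear functional below
  \<open>p\<close> whose value at \<open>- z\<close> is at most \<open>- p z\<close>. A linear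
  functional below it must therefore agree with \<open>p\<close> at \<open>z\<close>.\<close>

definition tilt :: "('a::real_vector \<Rightarrow> real) \<Rightarrow> 'a \<Rightarrow> 'a \<Rightarrow> real"
  where "tilt p z x = (INF s\<in>{0..}. p (x + s *\<^sub>R z) - s * p z)"

lemma tilt_le:
  assumes p: "sublinear p" and "s \<ge> 0"
  shows "tilt p z x \<le> p (x + s *\<^sub>R z) - s * p z"
  unfolding tilt_def
proof (rule cINF_lower)
  \<comment> \<open>The real infimum needs a lower bound independent of \<open>s\<close>;
    subadditivity on s z = (x + s z) + (- x) provides it.\<close>
  have "- p (- x) \<le> p (x + s *\<^sub>R z) - s * p z" if "s \<ge> 0" for s
    using sublinear_add[OF p, of "x + s *\<^sub>R z" "- x"] sublinear_scaleR[OF p that, of z] by simp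
  then show "bdd_below ((\<lambda>s. p (x + s *\<^sub>R z) - s * p z) ` {0..})"
    by (auto intro!: bdd_belowI2)
qed (use assms in auto)

lemma tilt_greatest:
  assumes "\<And>s. s \<ge> 0 \<Longrightarrow> m \<le> p (x + s *\<^sub>R z) - s * p z"
  shows "m \<le> tilt p z x"
  unfolding tilt_def by (rule cINF_greatest) (use assms in auto)

lemma sublinear_tilt:
  assumes p: "sublinear p" shows "sublinear (tilt p z)"
proof -
  have "tilt p z (x + y) \<le> tilt p z x + tilt p z y" for x y
  proof -
    \<comment> \<open>The two infima are handled one after the other: over \<open>s\<close> with
      \<open>r\<close> fixed, then over \<open>r\<close>.\<close>
    have "tilt p z (x + y) - (p (y + r *\<^sub>R z) - r * p z) \<le> tilt p z x" if "r \<ge> 0" for r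
    proof (rule tilt_greatest)
      fix s :: real assume "s \<ge> 0"
      with that have "tilt p z (x + y) \<le> p ((x + y) + (s + r) *\<^sub>R z) - (s + r) * p z"
        by (intro tilt_le[OF p]) auto
      also have "(x + y) + (s + r) *\<^sub>R z = (x + s *\<^sub>R z) + (y + r *\<^sub>R z)"
        by (simp add: algebra_simps)
      also have "p \<dots> \<le> p (x + s *\<^sub>R z) + p (y + r *\<^sub>R z)"
        by (rule sublinear_add[OF p])
      finally show "tilt p z (x + y) - (p (y + r *\<^sub>R z) - r * p z)
          \<le> p (x + s *\<^sub>R z) - s * p z"
        by (simp add: algebra_simps)
    qed
    then have "tilt p z (x + y) - tilt p z x \<le> p (y + r *\<^sub>R z) - r * p z" if "r \<ge> 0" for r
      using that by (simp add: algebra_simps)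
    then have "tilt p z (x + y) - tilt p z x \<le> tilt p z y"
      by (rule tilt_greatest)
    then show ?thesis by simp
  qed
  moreover have "tilt p z (c *\<^sub>R x) \<le> c * tilt p z x" if "c > 0" for c x
  proof -
    have "inverse c * tilt p z (c *\<^sub>R x) \<le> tilt p z x"
    proof (rule tilt_greatest)
      fix s :: real assume "s \<ge> 0"
      with that have "tilt p z (c *\<^sub>R x) \<le> p (c *\<^sub>R x + (c * s) *\<^sub>R z) - (c * s) * p z"
        by (intro tilt_le[OF p]) auto
      also have "c *\<^sub>R x + (c * s) *\<^sub>R z = c *\<^sub>R (x + s *\<^sub>R z)"
        by (simp add: algebra_simps)
      finally have "tilt p z (c *\<^sub>R x) \<le> c * (p (x + s *\<^sub>R z) - s * p z)"
        by (simp add: sublinear_scaleR_pos[OF p that] right_diff_distrib)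
      then show "inverse c * tilt p z (c *\<^sub>R x) \<le> p (x + s *\<^sub>R z) - s * p z"
        using that by (simp add: field_simps)
    qed
    then show ?thesis
      using that by (simp add: field_simps)
  qed
  ultimately show ?thesis
    by (simp add: sublinear_def)
qed

text \<open>A minimal sublinear functional \<open>q\<close> equals all its tilts, which makes it additive.\<close>

lemma sublinear_ge_linear:
  fixes p :: "'a::real_vector \<Rightarrow> real"
  assumes p: "sublinear p"
  shows "\<exists>\<Lambda>. linear \<Lambda> \<and> \<Lambda> \<le> p"
proof -
  define A where "A = {q. sublinear q \<and> q \<le> p}"
  \<comment> \<open>Zorn's lemma is used with the reversed pointwise order, so a maximal element is
    a minimal functional.\<close>
  have "\<exists>q\<in>A. \<forall>r\<in>A. q \<ge> r \<longrightarrow> r = q"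
  proof (rule predicate_Zorn)
    show "partial_order_on A (relation_of (\<ge>) A)"
      by (rule partial_order_on_relation_ofI) auto
  next
    fix C assume C: "C \<in> Chains (relation_of (\<ge>) A)"
    then have CA: "C \<subseteq> A"
      by (auto simp: Chains_def relation_of_def)
    have total: "q \<le> r \<or> r \<le> q" if "q \<in> C" "r \<in> C" for q r
      using C that by (auto simp: Chains_def relation_of_def)
    show "\<exists>u\<in>A. \<forall>q\<in>C. q \<ge> u"
    proof (cases "C = {}")
      case True
      then show ?thesis using p by (auto simp: A_def)
    next
      case False
      \<comment> \<open>The chain is bounded by its pointwise infimum, which is a genuine one
        because every member is at least \<open>- p (- x)\<close> at \<open>x\<close>.\<close>
      define u where "u x = (INF q\<in>C. q x)" for x
      have "- p (- x) \<le> q x" if "q \<in> C" for q x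
      proof -
        have "sublinear q" "q (- x) \<le> p (- x)"
          using that CA by (auto simp: A_def le_fun_def)
        then show ?thesis
          using sublinear_minus_le[of q x] by linarith
      qed
      then have le: "u x \<le> q x" if "q \<in> C" for q x
        unfolding u_def using that by (intro cINF_lower bdd_belowI2)
      have ge: "m \<le> u x" if "\<And>q. q \<in> C \<Longrightarrow> m \<le> q x" for m x
        unfolding u_def using False that by (intro cINF_greatest)
      have "u (x + y) \<le> u x + u y" for x y
      proof -
        \<comment> \<open>In a chain one member lies below both \<open>q\<close> and
          \<open>r\<close>, so the subadditivity of a single functional covers two different
          ones.\<close>
        have *: "u (x + y) \<le> q x + r y" if "q \<in> C" "r \<in> C" for q r
        proof -
          obtain s where s: "s \<in> C" "s \<le> q" "s \<le> r"
            using total[OF \<open>q \<in> C\<close> \<open>r \<in> C\<close>] \<open>q \<in> C\<close> \<open>r \<in> C\<close> by (meson order_refl)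
          then have "u (x + y) \<le> s (x + y)"
            by (intro le)
          also have "\<dots> \<le> s x + s y"
            using s CA by (intro sublinear_add) (auto simp: A_def)
          also have "\<dots> \<le> q x + r y"
            using s by (intro add_mono) (auto simp: le_fun_def)
          finally show ?thesis .
        qed
        have "u (x + y) - r y \<le> u x" if "r \<in> C" for r
          using *[OF _ that] by (intro ge) (simp add: algebra_simps)
        then have "u (x + y) - u x \<le> u y"
          by (intro ge) (simp add: algebra_simps)
        then show ?thesis by simp
      qed
      moreover have "u (c *\<^sub>R x) \<le> c * u x" if "c > 0" for c x
      proof -
        have "inverse c * u (c *\<^sub>R x) \<le> q x" if q: "q \<in> C" for q
        proof -
          have "sublinear q"
            using q CA by (auto simp: A_def)
          then have "u (c *\<^sub>R x) \<le> c * q x"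
            using le[OF q, of "c *\<^sub>R x"] \<open>c > 0\<close> by (simp add: sublinear_scaleR_pos)
          then show ?thesis
            using \<open>c > 0\<close> by (simp add: field_simps)
        qed
        then have "inverse c * u (c *\<^sub>R x) \<le> u x"
          by (rule ge)
        then show ?thesis
          using that by (simp add: field_simps)
      qed
      ultimately have "sublinear u"
        by (simp add: sublinear_def)
      moreover have "u \<le> p"
      proof (rule le_funI)
        fix x
        obtain q where "q \<in> C" using False by blast
        then have "u x \<le> q x" "q x \<le> p x"
          using le CA by (auto simp: A_def le_fun_def)
        then show "u x \<le> p x" by linarith
      qed
      ultimately show ?thesis
        using le by (intro bexI[of _ u]) (auto simp: A_def le_fun_def)
    qed
  qed
  then obtain q where q: "sublinear q" "q \<le> p"
    and minimal: "\<And>r. sublinear r \<Longrightarrow> r \<le> q \<Longrightarrow> r = q"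
    unfolding A_def by (auto intro: order_trans)
  have "tilt q z = q" for z
  proof (rule minimal)
    show "tilt q z \<le> q"
      using tilt_le[OF q(1), of 0] by (auto simp: le_fun_def)
  qed (rule sublinear_tilt[OF q(1)])
  then have "q (x + y) = q x + q y" for x y
    using tilt_le[OF q(1), of 1 y x] sublinear_add[OF q(1), of x y] by simp
  note add = this
  have neg: "q (- x) = - q x" for x
    using add[of x "- x"] sublinear_zero[OF q(1)] by simp
  have "q (c *\<^sub>R x) = c * q x" for c x
  proof (cases "c \<ge> 0")
    case False
    then show ?thesis
      using sublinear_scaleR[OF q(1), of "- c" x] neg[of "c *\<^sub>R x"] by simp
  qed (rule sublinear_scaleR[OF q(1)])
  with add have "linear q"
    by (intro linearI) auto
  with q(2) show ?thesis by blast
qed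

lemma hahn_banach_at:
  assumes p: "sublinear p"
  shows "\<exists>\<Lambda>. linear \<Lambda> \<and> \<Lambda> \<le> p \<and> \<Lambda> z = p z"
proof -
  obtain \<Lambda> where \<Lambda>: "linear \<Lambda>" "\<Lambda> \<le> tilt p z"
    using sublinear_ge_linear[OF sublinear_tilt[OF p]] by blast
  have le: "\<Lambda> x \<le> p x" for x
    using \<Lambda>(2) tilt_le[OF p, of 0 z x] by (auto simp: le_fun_def intro: order_trans)
  have "\<Lambda> (- z) \<le> - p z"
    using \<Lambda>(2) tilt_le[OF p, of 1 z "- z"] sublinear_zero[OF p]
    by (auto simp: le_fun_def intro: order_trans)
  then have "\<Lambda> z = p z"
    using le[of z] linear_neg[OF \<Lambda>(1), of z] by simp
  with \<Lambda>(1) le show ?thesis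
    by (auto simp: le_fun_def)
qed

section \<open>Minkowski functionals and algebraic separation\<close>

definition absorbing :: "'a::real_vector set \<Rightarrow> bool"
  where "absorbing U \<longleftrightarrow> (\<forall>x. \<exists>r>0. r *\<^sub>R x \<in> U)"

text \<open>The Minkowski functional of \<open>U\<close>. Absorption makes the set of radii nonempty
  and \<open>0\<close> bounds it below, as the real infimum requires.\<close>

definition gauge_of :: "'a::real_vector set \<Rightarrow> 'a \<Rightarrow> real"
  where "gauge_of U x = Inf {r. r > 0 \<and> (\<exists>u\<in>U. x = r *\<^sub>R u)}"

lemma gauge_of_le:
  assumes "r > 0" "u \<in> U"
  shows "gauge_of U (r *\<^sub>R u) \<le> r"
  unfolding gauge_of_def using assms by (intro cInf_lower) (auto intro!: bdd_belowI[of _ 0])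

lemma gauge_of_less:
  assumes "absorbing U" "gauge_of U x < c"
  obtains r u where "0 < r" "r < c" "u \<in> U" "x = r *\<^sub>R u"
proof -
  obtain r where r: "r > 0" "r *\<^sub>R x \<in> U"
    using assms(1) by (auto simp: absorbing_def)
  have "inverse r > 0 \<and> (\<exists>u\<in>U. x = inverse r *\<^sub>R u)"
    using r by (intro conjI bexI[of _ "r *\<^sub>R x"]) auto
  then have "{r. r > 0 \<and> (\<exists>u\<in>U. x = r *\<^sub>R u)} \<noteq> {}"
    by blast
  from cInf_lessD[OF this] assms(2) that show ?thesis
    unfolding gauge_of_def by blast
qed

lemma sublinear_gauge_of:
  assumes U: "convex U" "absorbing U"
  shows "sublinear (gauge_of U)"
proof -
  have "gauge_of U (x + y) \<le> gauge_of U x + gauge_of U y" for x y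
  proof (rule field_le_epsilon)
    fix e :: real assume "e > 0"
    then have "gauge_of U x < gauge_of U x + e / 2" "gauge_of U y < gauge_of U y + e / 2"
      by auto
    then obtain r u s w where r: "0 < r" "r < gauge_of U x + e / 2" "u \<in> U" "x = r *\<^sub>R u"
      and s: "0 < s" "s < gauge_of U y + e / 2" "w \<in> U" "y = s *\<^sub>R w"
      by (metis gauge_of_less[OF U(2)])
    have "(r / (r + s)) *\<^sub>R u + (s / (r + s)) *\<^sub>R w \<in> U"
      using r s by (intro convexD[OF U(1)]) (auto simp: add_divide_distrib[symmetric])
    then have "gauge_of U ((r + s) *\<^sub>R ((r / (r + s)) *\<^sub>R u + (s / (r + s)) *\<^sub>R w)) \<le> r + s"
      using r s by (intro gauge_of_le) auto
    also have "(r + s) *\<^sub>R ((r / (r + s)) *\<^sub>R u + (s / (r + s)) *\<^sub>R w) = x + y"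
      using r s by (simp add: scaleR_add_right)
    finally show "gauge_of U (x + y) \<le> gauge_of U x + gauge_of U y + e"
      using r s by simp
  qed
  moreover have "gauge_of U (c *\<^sub>R x) \<le> c * gauge_of U x" if "c > 0" for c x
  proof (rule field_le_epsilon)
    fix e :: real assume "e > 0"
    then have "gauge_of U x < gauge_of U x + e / c"
      using that by auto
    then obtain r u where r: "0 < r" "r < gauge_of U x + e / c" "u \<in> U" "x = r *\<^sub>R u"
      by (metis gauge_of_less[OF U(2)])
    then have "gauge_of U (c *\<^sub>R x) \<le> c * r"
      using that gauge_of_le[of "c * r" u U] by simp
    also have "\<dots> \<le> c * gauge_of U x + e"
      using r that by (simp add: field_simps)
    finally show "gauge_of U (c *\<^sub>R x) \<le> c * gauge_of U x + e" .
  qed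
  ultimately show ?thesis
    by (simp add: sublinear_def)
qed

text \<open>Being purely algebraic, this serves the space, its product with the reals and the dual
  alike. The bound on \<open>W\<close> is what later makes \<Lambda> continuous, or a combination of
  evaluations.\<close>

lemma separate_from_absorbing:
  fixes C W :: "'a::real_vector set"
  assumes C: "convex C" "C \<noteq> {}"
    and W: "convex W" "absorbing W" and disjoint: "C \<inter> W = {}"
  shows "\<exists>\<Lambda> (m::real). linear \<Lambda> \<and> m > 0 \<and> (\<forall>w\<in>W. \<Lambda> w \<le> m) \<and> (\<forall>c\<in>C. m \<le> \<Lambda> c)"
proof -
  obtain c\<^sub>0 where c0: "c\<^sub>0 \<in> C"
    using C(2) by blast
  \<comment> \<open>Translating \<open>W\<close> - \<open>C\<close> by a point of \<open>C\<close>
    keeps \<open>W\<close> inside \<open>U\<close> and turns disjointness into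
    \<open>c\<^sub>0 \<notin> U\<close>, so the gauge of \<open>U\<close> is at least 1
    there.\<close>
  define U where "U = {c\<^sub>0 - c + w | c w. c \<in> C \<and> w \<in> W}"
  have "W \<subseteq> U"
    using c0 by (force simp: U_def)
  with W(2) have absU: "absorbing U"
    unfolding absorbing_def by blast
  have convU: "convex U"
    unfolding convex_def
  proof (intro ballI allI impI)
    fix x y and a b :: real
    assume "x \<in> U" "y \<in> U" and ab: "0 \<le> a" "0 \<le> b" "a + b = 1"
    then obtain c w c' w' where 1: "c \<in> C" "w \<in> W" "x = c\<^sub>0 - c + w"
      "c' \<in> C" "w' \<in> W" "y = c\<^sub>0 - c' + w'"
      unfolding U_def by blast
    have "a *\<^sub>R x + b *\<^sub>R y =
        (a + b) *\<^sub>R c\<^sub>0 - (a *\<^sub>R c + b *\<^sub>R c') + (a *\<^sub>R w + b *\<^sub>R w')"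
      by (simp add: 1 algebra_simps)
    moreover have "a *\<^sub>R c + b *\<^sub>R c' \<in> C" "a *\<^sub>R w + b *\<^sub>R w' \<in> W"
      using 1 ab C(1) W(1) by (auto intro: convexD)
    ultimately show "a *\<^sub>R x + b *\<^sub>R y \<in> U"
      unfolding U_def ab(3) scaleR_one by blast
  qed
  have notin: "c\<^sub>0 \<notin> U"
    using disjoint by (auto simp: U_def)
  have zero: "0 \<in> U"
    using absU by (auto simp: absorbing_def dest: spec[of _ 0])
  have ge1: "gauge_of U c\<^sub>0 \<ge> 1"
  proof (rule ccontr)
    assume "\<not> gauge_of U c\<^sub>0 \<ge> 1"
    then obtain r u where "0 < r" "r < 1" "u \<in> U" "c\<^sub>0 = r *\<^sub>R u"
      using gauge_of_less[OF absU, of c\<^sub>0 1] by (metis not_le)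
    then have "c\<^sub>0 \<in> U"
      using convexD[OF convU zero, of u "1 - r" r] by simp
    with notin show False ..
  qed
  obtain \<Lambda> where \<Lambda>: "linear \<Lambda>" "\<Lambda> \<le> gauge_of U" "\<Lambda> c\<^sub>0 = gauge_of U c\<^sub>0"
    using hahn_banach_at[OF sublinear_gauge_of[OF convU absU]] by blast
  have WC: "\<Lambda> w \<le> \<Lambda> c" if "w \<in> W" "c \<in> C" for w c
  proof -
    have "c\<^sub>0 - c + w \<in> U"
      using that by (auto simp: U_def)
    then have "\<Lambda> (c\<^sub>0 - c + w) \<le> 1"
      using \<Lambda>(2) gauge_of_le[of 1 "c\<^sub>0 - c + w" U] by (auto simp: le_fun_def intro: order_trans)
    then show ?thesis
      using \<Lambda>(3) ge1 by (simp add: linear_add[OF \<Lambda>(1)] linear_diff[OF \<Lambda>(1)])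
  qed
  have bdd: "bdd_above (\<Lambda> ` W)"
    using WC[OF _ c0] by (intro bdd_aboveI2)
  \<comment> \<open>The level \<open>m\<close> will be the supremum of \<Lambda> on
    \<open>W\<close>; it is positive because \<open>W\<close> contains a positive multiple of
    \<open>c\<^sub>0\<close>, where \<Lambda> is positive.\<close>
  obtain r where r: "r > 0" "r *\<^sub>R c\<^sub>0 \<in> W"
    using W(2) by (auto simp: absorbing_def)
  show ?thesis
  proof (intro exI conjI ballI)
    show "linear \<Lambda>" by (rule \<Lambda>(1))
    have "0 < \<Lambda> (r *\<^sub>R c\<^sub>0)"
      using \<Lambda>(3) ge1 r(1) by (simp add: linear_cmul[OF \<Lambda>(1)])
    also have "\<dots> \<le> (SUP w\<in>W. \<Lambda> w)"
      using r(2) bdd by (rule cSUP_upper)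
    finally show "(SUP w\<in>W. \<Lambda> w) > 0" .
    show "\<Lambda> w \<le> (SUP w\<in>W. \<Lambda> w)" if "w \<in> W" for w
      using that bdd by (rule cSUP_upper)
    show "(SUP w\<in>W. \<Lambda> w) \<le> \<Lambda> c" if "c \<in> C" for c
      using r(2) WC[OF _ that] by (intro cSUP_least) auto
  qed
qed

text \<open>Induction on \<open>F\<close>: if \<open>g j\<close> is nonzero at some \<open>z\<close>
  in the common kernel of the others, subtracting a multiple of \<open>g j\<close> makes \<Lambda>
  vanish at \<open>z\<close>, and the rest vanishes on that kernel. Otherwise \<open>g j\<close>
  vanishes there and gets coefficient 0.\<close>

lemma linear_vanishing_on_kernels:
  fixes \<Lambda> :: "'a::real_vector \<Rightarrow> real"
  assumes "finite F" "linear \<Lambda>" "\<And>i. i \<in> F \<Longrightarrow> linear (g i)"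
    and "\<And>x. (\<And>i. i \<in> F \<Longrightarrow> g i x = 0) \<Longrightarrow> \<Lambda> x = 0"
  shows "\<exists>c. \<forall>x. \<Lambda> x = (\<Sum>i\<in>F. c i * g i x)"
  using assms
proof (induction F arbitrary: \<Lambda> rule: finite_induct)
  case empty
  then show ?case by simp
next
  case (insert j F)
  show ?case
  proof (cases "\<exists>z. (\<forall>i\<in>F. g i z = 0) \<and> g j z \<noteq> 0")
    case True
    then obtain z where z: "\<And>i. i \<in> F \<Longrightarrow> g i z = 0" "g j z \<noteq> 0" by blast
    define k where "k = \<Lambda> z / g j z"
    have lj: "linear (g j)" using insert by blast
    have "\<exists>c. \<forall>x. \<Lambda> x - k * g j x = (\<Sum>i\<in>F. c i * g i x)"
    proof (rule insert.IH)
      show "linear (\<lambda>x. \<Lambda> x - k * g j x)"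
        using insert.prems(1) lj
        by (intro linearI) (auto simp: linear_add linear_cmul algebra_simps)
      show "linear (g i)" if "i \<in> F" for i
        using insert that by blast
      fix x assume x: "\<And>i. i \<in> F \<Longrightarrow> g i x = 0"
      define y where "y = x - (g j x / g j z) *\<^sub>R z"
      have "\<Lambda> y = 0"
      proof (rule insert.prems(3))
        fix i assume i: "i \<in> insert j F"
        then have "linear (g i)" using insert by blast
        then show "g i y = 0"
          using i x z by (auto simp: y_def linear_diff linear_cmul)
      qed
      then show "\<Lambda> x - k * g j x = 0"
        using insert.prems(1) z(2) by (simp add: y_def k_def linear_diff linear_cmul)
    qed
    then obtain c where c: "\<And>x. \<Lambda> x - k * g j x = (\<Sum>i\<in>F. c i * g i x)" by blast
    have "\<Lambda> x = (\<Sum>i\<in>insert j F. (c(j := k)) i * g i x)" for x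
    proof -
      have "(\<Sum>i\<in>F. (c(j := k)) i * g i x) = (\<Sum>i\<in>F. c i * g i x)"
        using insert.hyps by (intro sum.cong) auto
      then show ?thesis
        using c[of x] insert.hyps by simp
    qed
    then show ?thesis by blast
  next
    case False
    then have "\<exists>c. \<forall>x. \<Lambda> x = (\<Sum>i\<in>F. c i * g i x)"
    proof (intro insert.IH)
      fix x assume "\<And>i. i \<in> F \<Longrightarrow> g i x = 0"
      with False show "\<Lambda> x = 0"
        by (intro insert.prems) blast
    qed (use insert.prems in auto)
    then obtain c where c: "\<And>x. \<Lambda> x = (\<Sum>i\<in>F. c i * g i x)" by blast
    have "\<Lambda> x = (\<Sum>i\<in>insert j F. (c(j := 0)) i * g i x)" for x
    proof -
      have "(\<Sum>i\<in>F. (c(j := 0)) i * g i x) = (\<Sum>i\<in>F. c i * g i x)"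
        using insert.hyps by (intro sum.cong) auto
      then show ?thesis
        using c[of x] insert.hyps by simp
    qed
    then show ?thesis by blast
  qed
qed

text \<open>The slab contains the common kernel of the \<open>g i\<close>, and a linear functional that is bounded
  above on a subspace vanishes there.\<close>

lemma linear_bounded_on_slab:
  fixes \<Lambda> :: "'a::real_vector \<Rightarrow> real"
  assumes F: "finite F" and \<Lambda>: "linear \<Lambda>" and g: "\<And>i. i \<in> F \<Longrightarrow> linear (g i)"
    and "\<delta> > 0" and le: "\<And>x. \<forall>i\<in>F. \<bar>g i x\<bar> < \<delta> \<Longrightarrow> \<Lambda> x \<le> m"
  shows "\<exists>c. \<forall>x. \<Lambda> x = (\<Sum>i\<in>F. c i * g i x)"
proof (rule linear_vanishing_on_kernels[OF F \<Lambda> g])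
  fix x assume x: "\<And>i. i \<in> F \<Longrightarrow> g i x = 0"
  have "a * \<Lambda> x \<le> m" for a
    using le[of "a *\<^sub>R x"] x \<open>\<delta> > 0\<close> by (simp add: linear_cmul[OF \<Lambda>] linear_cmul[OF g])
  from this[of "(m + 1) / \<Lambda> x"] show "\<Lambda> x = 0"
    by (cases "\<Lambda> x = 0") auto
qed

text \<open>Slabs play the role of weak neighbourhoods of \<open>0\<close>, in a form to which
  algebraic separation applies.\<close>

lemma slab_convex_absorbing:
  fixes g :: "'i \<Rightarrow> 'a::real_vector \<Rightarrow> real"
  assumes F: "finite F" and g: "\<And>i. i \<in> F \<Longrightarrow> linear (g i)" and "\<delta> > 0"
  shows "convex {x. \<forall>i\<in>F. \<bar>g i x\<bar> < \<delta>}" "absorbing {x. \<forall>i\<in>F. \<bar>g i x\<bar> < \<delta>}"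
proof -
  have "{x. \<forall>i\<in>F. \<bar>g i x\<bar> < \<delta>} = (\<Inter>i\<in>F. g i -` {- \<delta> <..< \<delta>})"
    by (auto simp: abs_less_iff)
  then show "convex {x. \<forall>i\<in>F. \<bar>g i x\<bar> < \<delta>}"
    using g by (auto intro!: convex_INT convex_linear_vimage)
  show "absorbing {x. \<forall>i\<in>F. \<bar>g i x\<bar> < \<delta>}"
    unfolding absorbing_def
  proof
    fix x
    define M where "M = (\<Sum>i\<in>F. \<bar>g i x\<bar>) + 1"
    have M: "\<bar>g i x\<bar> < M" if "i \<in> F" for i
      using member_le_sum[of i F "\<lambda>i. \<bar>g i x\<bar>"] that F by (auto simp: M_def)
    have "M > 0"
      by (auto simp: M_def intro!: add_nonneg_pos sum_nonneg)
    then have "\<bar>g i ((\<delta> / M) *\<^sub>R x)\<bar> < \<delta>" if "i \<in> F" for i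
      using M[OF that] \<open>\<delta> > 0\<close> by (simp add: linear_cmul[OF g[OF that]] abs_mult field_simps)
    then show "\<exists>r>0. r *\<^sub>R x \<in> {x. \<forall>i\<in>F. \<bar>g i x\<bar> < \<delta>}"
      using \<open>\<delta> > 0\<close> \<open>M > 0\<close> by (intro exI[of _ "\<delta> / M"]) auto
  qed
qed

section \<open>Continuous functionals on a locally convex space\<close>

lemma tendsto_scaleR_lcs:
  fixes g :: "'b \<Rightarrow> 'a::locally_convex_space"
  assumes "(f \<longlongrightarrow> a) F" "(g \<longlongrightarrow> x) F"
  shows "((\<lambda>t. f t *\<^sub>R g t) \<longlongrightarrow> a *\<^sub>R x) F"
  using filterlim_compose[OF tendsto_scaleR_Pair filterlim_Pair[OF assms]] by simp

lemma continuous_on_scaleR_lcs: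
  fixes g :: "'b::topological_space \<Rightarrow> 'a::locally_convex_space"
  assumes "continuous_on S f" "continuous_on S g"
  shows "continuous_on S (\<lambda>t. f t *\<^sub>R g t)"
  using assms unfolding continuous_on_def by (auto intro: tendsto_scaleR_lcs)

lemma absorbing_nhd:
  fixes W :: "'a::locally_convex_space set"
  assumes "open W" "0 \<in> W"
  shows "absorbing W"
  unfolding absorbing_def
proof
  fix x
  have "open ((\<lambda>r::real. r *\<^sub>R x) -` W)"
    using assms(1) by (intro open_vimage continuous_on_scaleR_lcs continuous_intros)
  moreover have "0 \<in> (\<lambda>r::real. r *\<^sub>R x) -` W"
    using assms(2) by simp
  ultimately obtain e where e: "e > 0" "ball 0 e \<subseteq> (\<lambda>r::real. r *\<^sub>R x) -` W"
    using open_contains_ball by blast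
  then have "e / 2 \<in> ball 0 e"
    by (auto simp: dist_real_def)
  with e(2) have "(e / 2) *\<^sub>R x \<in> W"
    by blast
  with e(1) show "\<exists>r>0. r *\<^sub>R x \<in> W"
    by (intro exI[of _ "e / 2"]) auto
qed

text \<open>A one-sided bound suffices, because the neighbourhood can be symmetrised by using both
  \<open>y - x\<close> and \<open>x - y\<close>.\<close>

lemma continuous_if_bounded_above_nhd:
  fixes \<Lambda> :: "'a::locally_convex_space \<Rightarrow> real"
  assumes \<Lambda>: "linear \<Lambda>" and W: "open W" "0 \<in> W" and le: "\<And>w. w \<in> W \<Longrightarrow> \<Lambda> w \<le> m"
  shows "continuous_on UNIV \<Lambda>"
  unfolding continuous_on_def
proof (intro ballI tendstoI)
  fix x :: 'a and e :: real assume "e > 0"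
  have "m \<ge> 0"
    using le[OF W(2)] linear_0[OF \<Lambda>] by simp
  \<comment> \<open>The summand 1 makes \<open>m < k * e\<close> strict and \<open>k\<close>
    positive even if \<open>m = 0\<close>.\<close>
  define k where "k = (m + 1) / e"
  have "k > 0"
    using \<open>m \<ge> 0\<close> \<open>e > 0\<close> by (auto simp: k_def)
  define N where "N = (\<lambda>y. k *\<^sub>R (y - x)) -` W \<inter> (\<lambda>y. k *\<^sub>R (x - y)) -` W"
  have "open N"
    unfolding N_def using W(1)
    by (intro open_Int open_vimage continuous_on_scaleR_lcs continuous_intros)
  moreover have "x \<in> N"
    using W(2) by (simp add: N_def)
  moreover have "dist (\<Lambda> y) (\<Lambda> x) < e" if "y \<in> N" for y
  proof -
    have "k * (\<Lambda> y - \<Lambda> x) \<le> m" "k * (\<Lambda> x - \<Lambda> y) \<le> m"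
      using that le[of "k *\<^sub>R (y - x)"] le[of "k *\<^sub>R (x - y)"]
      by (auto simp: N_def linear_cmul[OF \<Lambda>] linear_diff[OF \<Lambda>])
    then have "k * \<bar>\<Lambda> y - \<Lambda> x\<bar> \<le> m"
      by (cases "\<Lambda> y \<ge> \<Lambda> x") (auto simp: abs_if)
    also have "m < k * e"
      using \<open>e > 0\<close> by (simp add: k_def)
    finally show ?thesis
      using \<open>k > 0\<close> by (simp add: dist_real_def)
  qed
  ultimately show "\<forall>\<^sub>F y in at x within UNIV. dist (\<Lambda> y) (\<Lambda> x) < e"
    unfolding eventually_at_topological by blast
qed

section \<open>Separation by elements of the dual and in the dual\<close>

lemma linear_dual_apply: "linear (dual_apply \<phi>)"
  and continuous_dual_apply: "continuous_on UNIV (dual_apply \<phi>)"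
  using dual_apply[of \<phi>] by auto

lemma dual_apply_Dual:
  "linear \<Lambda> \<Longrightarrow> continuous_on UNIV \<Lambda> \<Longrightarrow> dual_apply (Dual \<Lambda>) = \<Lambda>"
  by (simp add: Dual_inverse)

lemmas dual_apply_linear_simps =
  linear_0[OF linear_dual_apply] linear_add[OF linear_dual_apply]
  linear_diff[OF linear_dual_apply] linear_neg[OF linear_dual_apply]
  linear_cmul[OF linear_dual_apply] linear_sum[OF linear_dual_apply]

lemmas dual_rep_eqs =
  zero_dual.rep_eq plus_dual.rep_eq minus_dual.rep_eq uminus_dual.rep_eq scaleR_dual.rep_eq

lemma linear_evaluation: "linear (\<lambda>\<phi>. dual_apply \<phi> v)"
  by (intro linearI) (auto simp: dual_rep_eqs)

text \<open>The Hausdorff axiom enters here: it gives a convex neighbourhood of \<open>0\<close>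
  that misses \<open>v\<close>, and separation yields a functional with value at least
  \<open>m > 0\<close> at \<open>v\<close>.\<close>

lemma dual_separates_points:
  fixes v :: "'a::locally_convex_space"
  assumes "v \<noteq> 0"
  shows "\<exists>\<phi>. dual_apply \<phi> v \<noteq> 0"
proof -
  obtain U where U: "open U" "0 \<in> U" "v \<notin> U"
    using t1_space[of 0 v] assms by blast
  then obtain V where V: "open V" "convex V" "0 \<in> V" "V \<subseteq> U"
    using ex_open_convex_subset[OF U(1,2)] by blast
  have "{v} \<inter> V = {}"
    using V(4) U(3) by auto
  from separate_from_absorbing[OF convex_singleton _ V(2) absorbing_nhd[OF V(1,3)] this]
  obtain \<Lambda> and m :: real where \<Lambda>: "linear \<Lambda>" "m > 0" "\<forall>w\<in>V. \<Lambda> w \<le> m" "m \<le> \<Lambda> v"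
    by auto
  then have "continuous_on UNIV \<Lambda>"
    using V by (intro continuous_if_bounded_above_nhd[of \<Lambda> V m]) auto
  then show ?thesis
    using \<Lambda>(1,2,4) by (intro exI[of _ "Dual \<Lambda>"]) (simp add: dual_apply_Dual)
qed

text \<open>If no such \<phi> existed, evaluation at \<open>b\<close> would vanish on the common
  kernel of the other evaluations, hence be a combination of them. As the dual separates points,
  \<open>b\<close> would be the same combination of the other vectors.\<close>

lemma dual_biorthogonal:
  fixes B :: "'a::locally_convex_space set"
  assumes "finite B" "independent B" "b \<in> B"
  shows "\<exists>\<phi>. dual_apply \<phi> b = 1 \<and> (\<forall>c\<in>B - {b}. dual_apply \<phi> c = 0)"
proof (cases "\<exists>\<phi>. dual_apply \<phi> b \<noteq> 0 \<and> (\<forall>c\<in>B - {b}. dual_apply \<phi> c = 0)")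
  case True
  then obtain \<phi> where "dual_apply \<phi> b \<noteq> 0" "\<forall>c\<in>B - {b}. dual_apply \<phi> c = 0"
    by blast
  then show ?thesis
    by (intro exI[of _ "inverse (dual_apply \<phi> b) *\<^sub>R \<phi>"]) (simp add: scaleR_dual.rep_eq)
next
  case False
  then have "\<exists>k. \<forall>\<phi>. dual_apply \<phi> b = (\<Sum>c\<in>B - {b}. k c * dual_apply \<phi> c)"
  proof (intro linear_vanishing_on_kernels linear_evaluation)
    fix \<phi> :: "'a dual" assume "\<And>c. c \<in> B - {b} \<Longrightarrow> dual_apply \<phi> c = 0"
    with False show "dual_apply \<phi> b = 0"
      by blast
  qed (use assms(1) in simp)
  then obtain k where k: "\<And>\<phi>. dual_apply \<phi> b = (\<Sum>c\<in>B - {b}. k c * dual_apply \<phi> c)"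
    by blast
  have "dual_apply \<phi> (b - (\<Sum>c\<in>B - {b}. k c *\<^sub>R c)) = 0" for \<phi>
    using k[of \<phi>] by (simp add: dual_apply_linear_simps)
  then have "b - (\<Sum>c\<in>B - {b}. k c *\<^sub>R c) = 0"
    using dual_separates_points[of "b - (\<Sum>c\<in>B - {b}. k c *\<^sub>R c)"] by blast
  moreover have "(\<Sum>c\<in>B - {b}. k c *\<^sub>R c) \<in> span (B - {b})"
    by (intro span_sum span_scale span_base)
  ultimately have "b \<in> span (B - {b})"
    by simp
  then show ?thesis
    using assms(2,3) unfolding dependent_def by blast
qed

lemma weak_star_nhd:
  assumes "x\<^sub>0 \<notin> closure K"
  shows "\<exists>F \<delta>. finite F \<and> \<delta> > 0 \<and> (\<forall>k\<in>K. \<exists>v\<in>F. \<bar>dual_apply (k - x\<^sub>0) v\<bar> \<ge> \<delta>)"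
proof -
  have "open (- closure K)" by auto
  then obtain V where V: "open V" "- closure K = dual_apply -` V"
    unfolding open_dual_def by blast
  have "dual_apply x\<^sub>0 \<in> V"
    using assms V(2) by blast
  have "\<exists>X. dual_apply x\<^sub>0 \<in> (\<Pi>\<^sub>E i\<in>UNIV. X i) \<and> (\<forall>i. openin euclidean (X i)) \<and>
      finite {i. X i \<noteq> topspace euclidean} \<and> (\<Pi>\<^sub>E i\<in>UNIV. X i) \<subseteq> V"
    using V(1) \<open>dual_apply x\<^sub>0 \<in> V\<close> unfolding open_fun_def
    by (rule product_topology_open_contains_basis)
  then obtain X where X: "dual_apply x\<^sub>0 \<in> (\<Pi>\<^sub>E i\<in>UNIV. X i)" "\<And>i. open (X i)"
    "finite {i. X i \<noteq> UNIV}" "(\<Pi>\<^sub>E i\<in>UNIV. X i) \<subseteq> V"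
    unfolding open_openin[symmetric] topspace_euclidean by blast
  define F where "F = {i. X i \<noteq> UNIV}"
  have "\<exists>d>0. ball (dual_apply x\<^sub>0 i) d \<subseteq> X i" for i
    using X(1,2) open_contains_ball[of "X i"] by (auto simp: PiE_def)
  then obtain d where d: "\<And>i. d i > 0" "\<And>i. ball (dual_apply x\<^sub>0 i) (d i) \<subseteq> X i"
    by metis
  \<comment> \<open>The inserted 1 keeps the minimum meaningful when \<open>F\<close> is
    empty.\<close>
  define \<delta> where "\<delta> = Min (insert 1 (d ` F))"
  have "finite F"
    using X(3) by (simp add: F_def)
  then have \<delta>: "\<delta> > 0" "\<And>i. i \<in> F \<Longrightarrow> \<delta> \<le> d i"
    using d(1) by (auto simp: \<delta>_def)
  have "\<exists>v\<in>F. \<bar>dual_apply (k - x\<^sub>0) v\<bar> \<ge> \<delta>" if k: "k \<in> K" for k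
  proof (rule ccontr)
    assume *: "\<not> ?thesis"
    have "dual_apply k i \<in> X i" for i
    proof (cases "i \<in> F")
      case True
      then have "\<bar>dual_apply k i - dual_apply x\<^sub>0 i\<bar> < d i"
        using * \<delta>(2)[of i] by (force simp: dual_rep_eqs)
      then show ?thesis
        using d(2)[of i] by (auto simp: dist_real_def abs_minus_commute subset_iff)
    qed (auto simp: F_def)
    then have "dual_apply k \<in> V"
      using X(4) by (auto simp: PiE_def)
    then have "k \<notin> closure K"
      using V(2) by blast
    then show False
      using k closure_subset by blast
  qed
  with \<open>finite F\<close> \<delta>(1) show ?thesis
    by blast
qed

text \<open>The separating functional on the dual is bounded on a slab of evaluations, so it is
  itself evaluation at a vector \<open>u\<close>. It is large on \<open>K\<close> minus
  \<open>x\<^sub>0\<close>, which is why the vector returned is \<open>- u\<close>.\<close>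

lemma weak_star_separation:
  fixes K :: "'a::locally_convex_space dual set"
  assumes K: "convex K" "K \<noteq> {}" and "x\<^sub>0 \<notin> closure K"
  obtains v \<beta> where "\<And>k. k \<in> K \<Longrightarrow> dual_apply k v \<le> \<beta>" "\<beta> < dual_apply x\<^sub>0 v"
proof -
  obtain F \<delta> where F: "finite F" "\<delta> > 0"
    "\<And>k. k \<in> K \<Longrightarrow> \<exists>v\<in>F. \<bar>dual_apply (k - x\<^sub>0) v\<bar> \<ge> \<delta>"
    using weak_star_nhd[OF assms(3)] by blast
  define C where "C = (\<lambda>k. k - x\<^sub>0) ` K"
  define W where "W = {\<phi>. \<forall>v\<in>F. \<bar>dual_apply \<phi> v\<bar> < \<delta>}"
  have "C \<inter> W = {}"
    using F(3) by (force simp: C_def W_def)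
  moreover have "convex C" "C \<noteq> {}"
    using K by (auto simp: C_def)
  moreover have "convex W" "absorbing W"
    unfolding W_def using F(1,2) by (auto intro: slab_convex_absorbing linear_evaluation)
  ultimately obtain \<Lambda> and m :: real where \<Lambda>: "linear \<Lambda>" "m > 0" "\<And>w. w \<in> W \<Longrightarrow> \<Lambda> w \<le> m"
    "\<And>c. c \<in> C \<Longrightarrow> m \<le> \<Lambda> c"
    using separate_from_absorbing[of C W] by blast
  have "\<exists>c. \<forall>\<phi>. \<Lambda> \<phi> = (\<Sum>v\<in>F. c v * dual_apply \<phi> v)"
    using F(1,2) \<Lambda>(1,3)
    by (intro linear_bounded_on_slab[of F \<Lambda> _ \<delta> m] linear_evaluation) (auto simp: W_def)
  then obtain c where c: "\<And>\<phi>. \<Lambda> \<phi> = (\<Sum>v\<in>F. c v * dual_apply \<phi> v)" by blast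
  define u where "u = (\<Sum>v\<in>F. c v *\<^sub>R v)"
  have u: "\<Lambda> \<phi> = dual_apply \<phi> u" for \<phi>
    by (simp add: c u_def dual_apply_linear_simps)
  show thesis
  proof (rule that)
    fix k assume "k \<in> K"
    then have "m \<le> \<Lambda> (k - x\<^sub>0)"
      by (intro \<Lambda>(4)) (auto simp: C_def)
    then show "dual_apply k (- u) \<le> dual_apply x\<^sub>0 (- u) - m"
      by (simp add: u dual_apply_linear_simps dual_rep_eqs)
  qed (use \<Lambda>(2) in auto)
qed

section \<open>Normal cones of finite-dimensional convex sets\<close>

text \<open>A direction in the polar of the normal cone lies only in the closure of the cone of feasible
  directions; adding a small multiple of a relatively interior direction makes it feasible.\<close>

lemma ex_feasible_perturbation:
  fixes C :: "'a::locally_convex_space set"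
  assumes C: "convex C" "x \<in> C" and F: "finite F" "\<And>y. y \<in> C \<Longrightarrow> y - x \<in> span F"
    and polar: "\<And>n. n \<in> normal_cone C x \<Longrightarrow> dual_apply n v \<le> 0"
  obtains y\<^sub>0 where "y\<^sub>0 \<in> C" "\<And>\<delta>. \<delta> > 0 \<Longrightarrow> \<exists>r>0. x + r *\<^sub>R (v + \<delta> *\<^sub>R (y\<^sub>0 - x)) \<in> C"
proof -
  have normalI: "n \<in> normal_cone C x" if "\<And>y. y \<in> C \<Longrightarrow> dual_apply n (y - x) \<le> 0" for n
    using that C(2) by (auto simp: normal_cone_eq)
  obtain B where B: "B \<subseteq> (\<lambda>y. y - x) ` C" "independent B" "(\<lambda>y. y - x) ` C \<subseteq> span B"
    using maximal_independent_subset[of "(\<lambda>y. y - x) ` C"] by blast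
  have "B \<subseteq> span F"
    using B(1) F(2) by blast
  then have fin: "finite B"
    using independent_span_bound[OF F(1) B(2)] by blast
  \<comment> \<open>\<open>Q\<close> is the cone of feasible directions; the aim is to put
    \<open>v\<close> plus a small multiple of the sum of the basis \<open>B\<close> into it.\<close>
  define Q where "Q = {s *\<^sub>R (y - x) | s y. s > 0 \<and> y \<in> C}"
  have Q0: "0 \<in> Q"
    using C(2) by (auto simp: Q_def intro!: exI[of _ "1::real"] exI[of _ x])
  have Q_scale: "c *\<^sub>R q \<in> Q" if c: "c \<ge> 0" and q: "q \<in> Q" for c q
  proof (cases "c = 0")
    case False
    then have "c > 0" using c by simp
    obtain s y where "q = s *\<^sub>R (y - x)" "s > 0" "y \<in> C"
      using q unfolding Q_def by blast
    with \<open>c > 0\<close> have "c *\<^sub>R q = (c * s) *\<^sub>R (y - x) \<and> c * s > 0 \<and> y \<in> C"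
      by auto
    then show ?thesis
      unfolding Q_def by blast
  qed (use Q0 in auto)
  have Q_add: "p + q \<in> Q" if pq: "p \<in> Q" "q \<in> Q" for p q
  proof -
    obtain s y t z where *: "p = s *\<^sub>R (y - x)" "s > 0" "y \<in> C" "q = t *\<^sub>R (z - x)" "t > 0" "z \<in> C"
      using pq unfolding Q_def by blast
    have "s + t > 0"
      using * by simp
    moreover have "(s / (s + t)) *\<^sub>R y + (t / (s + t)) *\<^sub>R z \<in> C"
      using * by (intro convexD[OF C(1)]) (auto simp: add_divide_distrib[symmetric])
    moreover have "(s + t) *\<^sub>R ((s / (s + t)) *\<^sub>R y + (t / (s + t)) *\<^sub>R z - x) = p + q"
      using \<open>s + t > 0\<close>
      by (simp add: * scaleR_right_diff_distrib scaleR_add_right scaleR_add_left)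
    ultimately show ?thesis
      unfolding Q_def by force
  qed
  have "B \<subseteq> Q"
    using B(1) by (force simp: Q_def intro!: exI[of _ "1::real"])
  have "(\<Sum>b\<in>A. c b *\<^sub>R b) \<in> Q" if "finite A" "A \<subseteq> B" "\<And>b. b \<in> A \<Longrightarrow> c b \<ge> 0" for A c
    using that
  proof (induction A rule: finite_induct)
    case (insert a A)
    then have "c a *\<^sub>R a \<in> Q"
      using \<open>B \<subseteq> Q\<close> by (intro Q_scale) auto
    then show ?case
      using insert by (simp add: Q_add)
  qed (simp add: Q0)
  then have Q_sum: "(\<Sum>b\<in>B. c b *\<^sub>R b) \<in> Q" if "\<And>b. b \<in> B \<Longrightarrow> c b \<ge> 0" for c
    using that fin by auto
  have Q_span: "q \<in> span B" if "q \<in> Q" for q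
    using that B(3) by (auto simp: Q_def intro!: span_scale)
  obtain s\<^sub>0 y\<^sub>0 where y0: "(\<Sum>b\<in>B. b) = s\<^sub>0 *\<^sub>R (y\<^sub>0 - x)" "s\<^sub>0 > 0" "y\<^sub>0 \<in> C"
    using Q_sum[of "\<lambda>_. 1"] unfolding Q_def by auto
  \<comment> \<open>Outside the span, a functional that is 1 at \<open>v\<close> and 0 on
    \<open>B\<close> would be normal to \<open>C\<close> and contradict
    \<open>polar\<close>.\<close>
  have "v \<in> span B"
  proof (rule ccontr)
    assume v: "v \<notin> span B"
    then have "independent (insert v B)"
      using B(2) by (simp add: independent_insert)
    then obtain \<phi> where \<phi>: "dual_apply \<phi> v = 1" "\<forall>c\<in>insert v B - {v}. dual_apply \<phi> c = 0"
      using dual_biorthogonal[of "insert v B" v] fin by auto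
    have "v \<notin> B"
      using v span_base by blast
    then have "\<forall>c\<in>B. dual_apply \<phi> c = 0"
      using \<phi>(2) by auto
    then have "dual_apply \<phi> z = 0" if "z \<in> span B" for z
      using linear_eq_0_on_span[OF linear_dual_apply _ that] by blast
    then have "\<phi> \<in> normal_cone C x"
      using B(3) by (intro normalI) auto
    then show False
      using polar[of \<phi>] \<phi>(1) by simp
  qed
  obtain \<phi> where \<phi>: "\<And>b. b \<in> B \<Longrightarrow> dual_apply (\<phi> b) b = 1"
    "\<And>b c. b \<in> B \<Longrightarrow> c \<in> B - {b} \<Longrightarrow> dual_apply (\<phi> b) c = 0"
    using dual_biorthogonal[OF fin B(2)] by metis
  have coords: "u = (\<Sum>b\<in>B. dual_apply (\<phi> b) u *\<^sub>R b)" if u: "u \<in> span B" for u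
  proof -
    obtain c where c: "u = (\<Sum>b\<in>B. c b *\<^sub>R b)"
      using u unfolding span_finite[OF fin] by blast
    have "dual_apply (\<phi> b) u = c b" if b: "b \<in> B" for b
    proof -
      have "dual_apply (\<phi> b) u = (\<Sum>a\<in>B. c a * dual_apply (\<phi> b) a)"
        by (simp add: c dual_apply_linear_simps)
      also have "\<dots> = (\<Sum>a\<in>B. if a = b then c b else 0)"
        using \<phi> b by (intro sum.cong) auto
      finally show ?thesis
        using fin b by simp
    qed
    then show ?thesis
      using c by simp
  qed
  have feasible: "v + \<delta> *\<^sub>R (\<Sum>b\<in>B. b) \<in> Q" if "\<delta> > 0" for \<delta>
  proof (rule ccontr)
    assume notin: "v + \<delta> *\<^sub>R (\<Sum>b\<in>B. b) \<notin> Q"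
    define W where "W = {u. \<forall>b\<in>B. \<bar>dual_apply (\<phi> b) u\<bar> < \<delta>}"
    define E where "E = (\<lambda>q. q - v) ` Q"
    \<comment> \<open>If the coordinates of \<open>q - v\<close> are below \<delta> in absolute
      value, then \<open>v + \<delta> *\<^sub>R (\<Sum>b\<in>B. b)\<close> is \<open>q\<close> plus
      a combination of \<open>B\<close> with positive coefficients, hence in
      \<open>Q\<close>.\<close>
    have "E \<inter> W = {}"
    proof (rule ccontr)
      assume "E \<inter> W \<noteq> {}"
      then obtain q where q: "q \<in> Q" "q - v \<in> W"
        by (auto simp: E_def)
      have "q - v \<in> span B"
        using Q_span[OF q(1)] \<open>v \<in> span B\<close> by (rule span_diff)
      from coords[OF this]
      have "v + \<delta> *\<^sub>R (\<Sum>b\<in>B. b) = q + (\<Sum>b\<in>B. (\<delta> - dual_apply (\<phi> b) (q - v)) *\<^sub>R b)"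
        by (simp add: scaleR_left_diff_distrib sum_subtractf scaleR_sum_right algebra_simps)
      moreover have "(\<Sum>b\<in>B. (\<delta> - dual_apply (\<phi> b) (q - v)) *\<^sub>R b) \<in> Q"
        using q(2) by (intro Q_sum) (force simp: W_def abs_less_iff)
      ultimately show False
        using notin Q_add q(1) by auto
    qed
    moreover have "convex Q"
      unfolding convex_def by (auto intro: Q_add Q_scale)
    then have "convex E" "E \<noteq> {}"
      using Q0 by (auto simp: E_def)
    moreover have "convex W" "absorbing W"
      unfolding W_def using fin \<open>\<delta> > 0\<close> by (auto intro: slab_convex_absorbing linear_dual_apply)
    ultimately obtain \<Lambda> and m :: real where \<Lambda>: "linear \<Lambda>" "m > 0" "\<And>w. w \<in> W \<Longrightarrow> \<Lambda> w \<le> m"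
      "\<And>c. c \<in> E \<Longrightarrow> m \<le> \<Lambda> c"
      using separate_from_absorbing[of E W] by blast
    have "\<exists>c. \<forall>u. \<Lambda> u = (\<Sum>b\<in>B. c b * dual_apply (\<phi> b) u)"
      using fin \<open>\<delta> > 0\<close> \<Lambda>(1,3)
      by (intro linear_bounded_on_slab[of B \<Lambda> _ \<delta> m] linear_dual_apply) (auto simp: W_def)
    then obtain c where c: "\<Lambda> = (\<lambda>u. \<Sum>b\<in>B. c b * dual_apply (\<phi> b) u)" by blast
    have "continuous_on UNIV \<Lambda>"
      unfolding c by (intro continuous_on_sum continuous_on_mult continuous_on_const continuous_dual_apply)
    then have n: "dual_apply (- Dual \<Lambda>) u = - \<Lambda> u" for u
      using \<Lambda>(1) by (simp add: dual_rep_eqs dual_apply_Dual)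
    \<comment> \<open>A functional bounded below on a cone is nonnegative on it. So
      \<open>- Dual \<Lambda>\<close> is normal and \<Lambda> is nonnegative at \<open>v\<close>,
      whereas \<open>0\<close> in \<open>Q\<close> gives the opposite strict sign.\<close>
    have "\<Lambda> (y - x) \<ge> 0" if "y \<in> C" for y
    proof (rule ccontr)
      assume neg: "\<not> \<Lambda> (y - x) \<ge> 0"
      have *: "m \<le> s * \<Lambda> (y - x) - \<Lambda> v" if "s > 0" for s
      proof -
        have "s *\<^sub>R (y - x) - v \<in> E"
          using that \<open>y \<in> C\<close> by (auto simp: E_def Q_def)
        then show ?thesis
          using \<Lambda>(4)[of "s *\<^sub>R (y - x) - v"] linear_diff[OF \<Lambda>(1), of "s *\<^sub>R (y - x)" v]
            linear_cmul[OF \<Lambda>(1), of s "y - x"] by simp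
      qed
      define s where "s = (\<bar>\<Lambda> v\<bar> + 1) / - \<Lambda> (y - x)"
      have "s > 0"
        unfolding s_def using neg by (intro divide_pos_pos) auto
      moreover have "s * \<Lambda> (y - x) = - (\<bar>\<Lambda> v\<bar> + 1)"
        using neg by (simp add: s_def)
      ultimately show False
        using *[of s] \<Lambda>(2) by linarith
    qed
    then have "- Dual \<Lambda> \<in> normal_cone C x"
      by (intro normalI) (simp add: n)
    then have "- \<Lambda> v \<le> 0"
      using polar n by metis
    moreover have "m \<le> \<Lambda> (0 - v)"
      using Q0 by (intro \<Lambda>(4)) (auto simp: E_def)
    ultimately show False
      using \<Lambda>(2) linear_neg[OF \<Lambda>(1), of v] by simp
  qed
  show thesis
  proof (rule that[OF y0(3)])
    fix \<delta> :: real assume "\<delta> > 0"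
    then have "v + (\<delta> / s\<^sub>0) *\<^sub>R (\<Sum>b\<in>B. b) \<in> Q"
      using y0(2) by (intro feasible) auto
    moreover have "(\<delta> / s\<^sub>0) *\<^sub>R (\<Sum>b\<in>B. b) = \<delta> *\<^sub>R (y\<^sub>0 - x)"
      using y0(2) by (simp add: y0(1))
    ultimately obtain s y where sy: "v + \<delta> *\<^sub>R (y\<^sub>0 - x) = s *\<^sub>R (y - x)" "s > 0" "y \<in> C"
      unfolding Q_def by auto
    then have "x + inverse s *\<^sub>R (v + \<delta> *\<^sub>R (y\<^sub>0 - x)) = y"
      by simp
    then show "\<exists>r>0. x + r *\<^sub>R (v + \<delta> *\<^sub>R (y\<^sub>0 - x)) \<in> C"
      using sy by (intro exI[of _ "inverse s"]) auto
  qed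
qed

section \<open>Convex lower semicontinuous functions\<close>

lemma convex_fun_line:
  assumes "convex_fun h" "h (x + p *\<^sub>R v) \<le> ereal A" "h (x + q *\<^sub>R v) \<le> ereal B" "0 \<le> \<theta>" "\<theta> \<le> 1"
  shows "h (x + ((1 - \<theta>) * p + \<theta> * q) *\<^sub>R v) \<le> ereal ((1 - \<theta>) * A + \<theta> * B)"
proof -
  have "(1 - \<theta>) *\<^sub>R (x + p *\<^sub>R v, A) + \<theta> *\<^sub>R (x + q *\<^sub>R v, B) \<in> {(x, r). h x \<le> ereal r}"
    using assms unfolding convex_fun_def by (intro convexD) auto
  moreover have "(1 - \<theta>) *\<^sub>R (x + p *\<^sub>R v) + \<theta> *\<^sub>R (x + q *\<^sub>R v) =
      x + ((1 - \<theta>) * p + \<theta> * q) *\<^sub>R v"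
    by (simp add: algebra_simps)
  ultimately show ?thesis
    by simp
qed

text \<open>A real \<open>c\<close> strictly between \<open>r\<close> and \<open>h x\<close> gives a
  box around the point. Openness in the product is the form that the tube lemma needs.\<close>

lemma lsc_fun_open_less:
  assumes "lsc_fun h"
  shows "open {(x, r::real). ereal r < h x}"
proof (subst open_subopen, rule ballI)
  fix z assume "z \<in> {(x, r::real). ereal r < h x}"
  then obtain x r where z: "z = (x, r)" "ereal r < h x" by auto
  then obtain c where c: "ereal r < ereal c" "ereal c < h x"
    using ereal_dense2 by blast
  have "{y. ereal c < h y} = - {y. h y \<le> ereal c}"
    by auto
  then have "open {y. ereal c < h y}"
    using assms unfolding lsc_fun_def by (simp add: open_Compl)
  then have "open ({y. ereal c < h y} \<times> {..<c})"
    by (intro open_Times) auto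
  moreover have "{y. ereal c < h y} \<times> {..<c} \<subseteq> {(x, r::real). ereal r < h x}"
    by (auto intro: less_trans less_ereal.simps(1)[THEN iffD2])
  ultimately show "\<exists>U. open U \<and> z \<in> U \<and> U \<subseteq> {(x, r::real). ereal r < h x}"
    using z c by (intro exI[of _ "{y. ereal c < h y} \<times> {..<c}"]) auto
qed

lemma convex_lsc_envelope_le: "convex_lsc_envelope g x \<le> g x"
  unfolding convex_lsc_envelope_def by (rule SUP_least) (auto simp: le_fun_def)

lemma convex_lsc_envelope_greatest:
  "convex_fun k \<Longrightarrow> lsc_fun k \<Longrightarrow> k \<le> g \<Longrightarrow> k x \<le> convex_lsc_envelope g x"
  unfolding convex_lsc_envelope_def by (rule SUP_upper) auto

text \<open>The epigraph of a supremum is the intersection of the epigraphs; lower semicontinuity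
  follows in the same way from sublevel sets.\<close>

lemma convex_fun_convex_lsc_envelope: "convex_fun (convex_lsc_envelope g)"
proof -
  have "{(x, r). convex_lsc_envelope g x \<le> ereal r} =
      (\<Inter>h\<in>{h. convex_fun h \<and> lsc_fun h \<and> h \<le> g}. {(x, r). h x \<le> ereal r})"
    by (auto simp: convex_lsc_envelope_def SUP_le_iff)
  then show ?thesis
    unfolding convex_fun_def by (auto intro!: convex_INT simp: convex_fun_def)
qed

lemma lsc_fun_convex_lsc_envelope: "lsc_fun (convex_lsc_envelope g)"
  unfolding lsc_fun_def
proof
  fix c
  have "{x. convex_lsc_envelope g x \<le> c} =
      (\<Inter>h\<in>{h. convex_fun h \<and> lsc_fun h \<and> h \<le> g}. {x. h x \<le> c})"
    by (auto simp: convex_lsc_envelope_def SUP_le_iff)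
  then show "closed {x. convex_lsc_envelope g x \<le> c}"
    by (auto intro!: closed_INT simp: lsc_fun_def)
qed

lemma convex_fun_affine: "convex_fun (\<lambda>y. ereal (a + dual_apply \<phi> (y - x)))"
  unfolding convex_fun_def
proof (rule convexI)
  fix p q :: "'a \<times> real" and u w :: real
  assume "p \<in> {(y, r). ereal (a + dual_apply \<phi> (y - x)) \<le> ereal r}"
    and "q \<in> {(y, r). ereal (a + dual_apply \<phi> (y - x)) \<le> ereal r}" and uw: "0 \<le> u" "0 \<le> w" "u + w = 1"
  then obtain y r z s where *: "p = (y, r)" "a + dual_apply \<phi> (y - x) \<le> r"
    "q = (z, s)" "a + dual_apply \<phi> (z - x) \<le> s" by auto
  then have "u * (a + dual_apply \<phi> (y - x)) + w * (a + dual_apply \<phi> (z - x)) \<le> u * r + w * s"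
    using uw by (intro add_mono mult_left_mono)
  moreover have "u * (a + dual_apply \<phi> (y - x)) + w * (a + dual_apply \<phi> (z - x)) =
      (u + w) * (a - dual_apply \<phi> x) + dual_apply \<phi> (u *\<^sub>R y + w *\<^sub>R z)"
    by (simp add: dual_apply_linear_simps algebra_simps)
  ultimately show "u *\<^sub>R p + w *\<^sub>R q \<in> {(y, r). ereal (a + dual_apply \<phi> (y - x)) \<le> ereal r}"
    using uw(3) by (simp add: * dual_apply_linear_simps)
qed

lemma lsc_fun_affine: "lsc_fun (\<lambda>y. ereal (a + dual_apply \<phi> (y - x)))"
proof -
  have "continuous_on UNIV (\<lambda>y. ereal (a + dual_apply \<phi> (y - x)))"
    unfolding dual_apply_linear_simps(3)
    by (intro continuous_on_ereal continuous_intros continuous_dual_apply)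
  then show ?thesis
    unfolding lsc_fun_def by (auto intro: closed_Collect_le)
qed

section \<open>Approximate subgradients and slopes along a ray\<close>

text \<open>The epigraph is separated from the segment over \<open>[0, S]\<close> of the line of slope \<open>b'\<close> through
  \<open>(x, h x - \<epsilon>)\<close>; the compactness of the segment gives a uniform gap, and cutting the ray at \<open>S\<close>
  costs \<open>\<epsilon> / S\<close> in the slope.\<close>

lemma ex_eps_subgradient:
  fixes h :: "'a::locally_convex_space \<Rightarrow> ereal"
  assumes h: "convex_fun h" "lsc_fun h" "h x = ereal a" and "\<epsilon> > 0"
    and above: "\<And>s. s > 0 \<Longrightarrow> ereal (a - \<epsilon> + s * b') < h (x + s *\<^sub>R v)" and "b < b'"
  shows "\<exists>\<phi>\<in>eps_subdifferential \<epsilon> h x. b < dual_apply \<phi> v"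
proof -
  \<comment> \<open>At this parameter the line of slope \<open>b'\<close> from height
    \<open>a - \<epsilon>\<close> meets the line of slope \<open>b\<close> from height
    \<open>a\<close>.\<close>
  define S where "S = \<epsilon> / (b' - b)"
  have S: "S > 0" "S * b' = S * b + \<epsilon>"
    using \<open>\<epsilon> > 0\<close> \<open>b < b'\<close> by (auto simp: S_def field_simps)
  \<comment> \<open>\<open>G\<close> displaces the point of the line at parameter
    \<open>snd z\<close> by the vector \<open>fst z\<close>; the tube lemma then finds one
    neighbourhood of displacements valid for the whole segment.\<close>
  define G where "G = (\<lambda>z :: ('a \<times> real) \<times> real.
    (x + snd z *\<^sub>R v + fst (fst z), a - \<epsilon> + snd z * b' + snd (fst z)))"
  have "open (G -` {(y, r). ereal r < h y})"
    unfolding G_def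
    by (intro open_vimage[OF lsc_fun_open_less[OF h(2)]] continuous_on_scaleR_lcs continuous_intros)
  moreover have "{(0, 0)} \<times> {0..S} \<subseteq> G -` {(y, r). ereal r < h y}"
  proof -
    have "ereal (a - \<epsilon> + s * b') < h (x + s *\<^sub>R v)" if "s \<ge> 0" for s
      using above[of s] that h(3) \<open>\<epsilon> > 0\<close> by (cases "s = 0") auto
    then show ?thesis
      by (auto simp: G_def)
  qed
  ultimately have "\<exists>X0. (0, 0) \<in> X0 \<and> open X0 \<and> X0 \<times> {0..S} \<subseteq> G -` {(y, r). ereal r < h y}"
    by (intro Elementary_Topology.tube_lemma compact_Icc)
  then obtain X0 where X0: "(0, 0) \<in> X0" "open X0"
    "X0 \<times> {0..S} \<subseteq> G -` {(y, r). ereal r < h y}"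
    by blast
  obtain A B where "open A" "open B" "(0, 0) \<in> A \<times> B" "A \<times> B \<subseteq> X0"
    by (rule open_prod_elim[OF X0(2,1)])
  then have AB: "open A" "open B" "0 \<in> A" "0 \<in> B" "A \<times> B \<subseteq> X0"
    by auto
  obtain V where V: "open V" "convex V" "0 \<in> V" "V \<subseteq> A"
    using ex_open_convex_subset[OF AB(1,3)] by blast
  obtain d where d: "d > 0" "ball 0 d \<subseteq> B"
    using AB(2,4) open_contains_ball by blast
  define W where "W = V \<times> ball (0::real) d"
  have W: "convex W" "absorbing W"
  proof -
    show "convex W"
      unfolding W_def using V(2) by (intro convex_Times) auto
    show "absorbing W"
      unfolding absorbing_def
    proof
      fix z :: "'a \<times> real"
      obtain u \<delta> where z: "z = (u, \<delta>)" by (cases z)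
      obtain r where r: "r > 0" "r *\<^sub>R u \<in> V"
        using absorbing_nhd[OF V(1,3)] by (auto simp: absorbing_def)
      obtain r' where r': "r' > 0" "r' *\<^sub>R \<delta> \<in> ball 0 d"
        using absorbing_nhd[of "ball (0::real) d"] d(1) by (force simp: absorbing_def)
      define m where "m = min r r'"
      have m: "m > 0" "0 \<le> m / r" "m / r \<le> 1" "0 \<le> m / r'" "m / r' \<le> 1"
        using r(1) r'(1) by (auto simp: m_def)
      have "m *\<^sub>R u \<in> V"
        using convexD[OF V(2,3) r(2), of "1 - m / r" "m / r"] m r(1) by simp
      moreover have "m *\<^sub>R \<delta> \<in> ball 0 d"
        using convexD[OF convex_ball centre_in_ball[THEN iffD2, OF d(1)] r'(2), of "1 - m / r'" "m / r'"]
          m r'(1) by simp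
      ultimately show "\<exists>r>0. r *\<^sub>R z \<in> W"
        using m(1) by (intro exI[of _ m]) (auto simp: W_def z)
    qed
  qed
  \<comment> \<open>\<open>C\<close> is the epigraph minus the segment, so its disjointness from
    \<open>W\<close> expresses the uniform gap.\<close>
  define C where "C = {(y - (x + s *\<^sub>R v), r - (a - \<epsilon> + s * b')) | y r s.
    h y \<le> ereal r \<and> s \<in> {0..S}}"
  have C_I: "(y - (x + s *\<^sub>R v), r - (a - \<epsilon> + s * b')) \<in> C" if "h y \<le> ereal r" "0 \<le> s" "s \<le> S" for y r s
    using that unfolding C_def by auto
  have "convex C"
  proof (rule convexI)
    fix p q :: "'a \<times> real" and u w :: real
    assume "p \<in> C" "q \<in> C" and uw: "0 \<le> u" "0 \<le> w" "u + w = 1"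
    then obtain y r s z t s' where *:
      "p = (y - (x + s *\<^sub>R v), r - (a - \<epsilon> + s * b'))" "h y \<le> ereal r" "s \<in> {0..S}"
      "q = (z - (x + s' *\<^sub>R v), t - (a - \<epsilon> + s' * b'))" "h z \<le> ereal t" "s' \<in> {0..S}"
      unfolding C_def by blast
    have "u *\<^sub>R (y, r) + w *\<^sub>R (z, t) \<in> {(x, r). h x \<le> ereal r}"
      using h(1) * uw unfolding convex_fun_def by (intro convexD) auto
    moreover have "u *\<^sub>R s + w *\<^sub>R s' \<in> {0..S}"
      using * uw by (intro convexD[OF convex_real_interval(5)])
    moreover have "u *\<^sub>R p + w *\<^sub>R q =
        ((u *\<^sub>R y + w *\<^sub>R z) - ((u + w) *\<^sub>R x + (u * s + w * s') *\<^sub>R v),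
         (u * r + w * t) - ((u + w) * (a - \<epsilon>) + (u * s + w * s') * b'))"
      by (simp add: * algebra_simps)
    ultimately show "u *\<^sub>R p + w *\<^sub>R q \<in> C"
      using C_I[of "u *\<^sub>R y + w *\<^sub>R z" "u * r + w * t" "u * s + w * s'"] uw(3) by simp
  qed
  moreover have "C \<noteq> {}"
    using C_I[of x a 0] h(3) S(1) by auto
  moreover have "C \<inter> W = {}"
  proof (rule ccontr)
    assume "C \<inter> W \<noteq> {}"
    then obtain y r s where *: "h y \<le> ereal r" "s \<in> {0..S}"
      "(y - (x + s *\<^sub>R v), r - (a - \<epsilon> + s * b')) \<in> W"
      unfolding C_def by blast
    moreover have "W \<subseteq> X0"
      unfolding W_def using AB(5) V(4) d(2) by blast
    ultimately have "(y - (x + s *\<^sub>R v), r - (a - \<epsilon> + s * b')) \<in> X0"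
      by blast
    then have "((y - (x + s *\<^sub>R v), r - (a - \<epsilon> + s * b')), s) \<in> G -` {(y, r). ereal r < h y}"
      using X0(3) *(2) by blast
    then have "ereal r < h y"
      by (simp add: G_def)
    then show False
      using *(1) by simp
  qed
  ultimately obtain \<Lambda> and m :: real where \<Lambda>: "linear \<Lambda>" "m > 0" "\<forall>w\<in>W. \<Lambda> w \<le> m" "\<forall>c\<in>C. m \<le> \<Lambda> c"
    using separate_from_absorbing[OF _ _ W, of C] by blast
  define g where "g y = \<Lambda> (y, 0)" for y
  define \<gamma> where "\<gamma> = \<Lambda> (0, 1)"
  have \<Lambda>_eq: "\<Lambda> (y, r) = g y + r * \<gamma>" for y r
    using linear_add[OF \<Lambda>(1), of "(y, 0)" "(0, r)"] linear_cmul[OF \<Lambda>(1), of r "(0, 1)"]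
    by (simp add: g_def \<gamma>_def)
  have g: "linear g"
    using linear_add[OF \<Lambda>(1), of "(_, 0)" "(_, 0)"] linear_cmul[OF \<Lambda>(1), of _ "(_, 0)"]
    by (intro linearI) (auto simp: g_def)
  have "g u \<le> m" if "u \<in> V" for u
    using \<Lambda>(3) that d(1) by (auto simp: g_def W_def)
  then have cont: "continuous_on UNIV g"
    by (rule continuous_if_bounded_above_nhd[OF g V(1,3)])
  have key: "m \<le> g (y - x) - s * g v + (r - a + \<epsilon> - s * b') * \<gamma>"
    if "h y \<le> ereal r" "0 \<le> s" "s \<le> S" for y r s
    using \<Lambda>(4)[rule_format, OF C_I[OF that]] linear_diff[OF g, of "y - x" "s *\<^sub>R v"]
    by (simp add: \<Lambda>_eq linear_cmul[OF g] algebra_simps)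
  \<comment> \<open>The point (x, a) lies \<epsilon> above the start of the segment, so the
    separating hyperplane is not vertical.\<close>
  have "m \<le> \<epsilon> * \<gamma>"
    using key[of x a 0] h(3) S(1) linear_0[OF g] by simp
  with \<open>m > 0\<close> \<open>\<epsilon> > 0\<close> have "\<gamma> > 0"
    by (metis less_le_trans zero_less_mult_pos)
  define \<phi> where "\<phi> = Dual (\<lambda>y. - g y / \<gamma>)"
  have \<phi>: "dual_apply \<phi> y = - g y / \<gamma>" for y
  proof -
    have "linear (\<lambda>y. - g y / \<gamma>)"
      by (intro linearI)
        (simp_all add: linear_add[OF g] linear_cmul[OF g] add_divide_distrib diff_divide_distrib)
    moreover have "continuous_on UNIV (\<lambda>y. - g y / \<gamma>)"
      using \<open>\<gamma> > 0\<close> by (intro continuous_intros cont) auto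
    ultimately show ?thesis
      unfolding \<phi>_def by (simp add: dual_apply_Dual)
  qed
  have le: "dual_apply \<phi> (y - x) \<le> r - a + \<epsilon>" if "h y \<le> ereal r" for y r
  proof -
    have "0 \<le> g (y - x) + (r - a + \<epsilon>) * \<gamma>"
      using key[OF that, of 0] S(1) \<open>m > 0\<close> by simp
    then show ?thesis
      using \<open>\<gamma> > 0\<close> by (simp add: \<phi> field_simps)
  qed
  have "ereal (dual_apply \<phi> (y - x)) \<le> h y - h x + ereal \<epsilon>" for y
  proof (cases "h y")
    case (real r)
    then show ?thesis
      using le[of y r] by (simp add: h(3))
  next
    \<comment> \<open>The value -\<infinity> is impossible: \<open>le\<close> would hold for every
      real \<open>r\<close>, and this \<open>r\<close> makes its right side one less than its left
      side.\<close>
    case MInf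
    then show ?thesis
      using le[of y "dual_apply \<phi> (y - x) + a - \<epsilon> - 1"] by simp
  qed (simp add: h(3))
  then have "\<phi> \<in> eps_subdifferential \<epsilon> h x"
    by (simp add: eps_subdifferential_def h(3))
  \<comment> \<open>The initial point \<open>s = 0\<close> gave the \<epsilon>-subgradient
    inequality; the far end \<open>s = S\<close>, tested against (x, a), gives the slope.\<close>
  moreover have "b < dual_apply \<phi> v"
  proof -
    have "0 < - S * g v + (\<epsilon> - S * b') * \<gamma>"
      using key[of x a S] h(3) S(1) \<open>m > 0\<close> linear_0[OF g] by simp
    also have "\<dots> = S * \<gamma> * (dual_apply \<phi> v - b)"
      using \<open>\<gamma> > 0\<close> by (simp add: \<phi> S(2) field_simps)
    finally have "S * \<gamma> * (dual_apply \<phi> v - b) > 0" .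
    then have "dual_apply \<phi> v - b > 0"
      by (rule zero_less_mult_pos) (use S(1) \<open>\<gamma> > 0\<close> in simp)
    then show ?thesis by simp
  qed
  ultimately show ?thesis by blast
qed

text \<open>The inequality \<open>\<theta> * (\<bar>R - a - r * \<beta>\<bar> + \<epsilon>) \<le> \<epsilon>\<close> for the interpolation weight \<open>\<theta>\<close> between
  \<open>p\<close> and \<open>r\<close> determines the step length, which must not depend on the index.\<close>

lemma ex_uniform_step:
  assumes h: "\<And>t. t \<in> T \<Longrightarrow> convex_fun (h t)" "\<And>t. t \<in> T \<Longrightarrow> h t x \<le> ereal a"
    and r: "r > 0" "\<And>t. t \<in> T \<Longrightarrow> h t (x + r *\<^sub>R v) \<le> ereal R" and "\<epsilon> > 0"
    and p: "\<And>t. t \<in> T \<Longrightarrow> \<exists>p\<ge>0. h t (x + p *\<^sub>R v) \<le> ereal (a - \<epsilon> + p * \<beta>)"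
  shows "\<exists>s>0. s \<le> r \<and> (\<forall>t\<in>T. h t (x + s *\<^sub>R v) \<le> ereal (a + s * \<beta>))"
proof -
  \<comment> \<open>\<kappa> measures how far \<open>R\<close> exceeds the line of slope \<beta>
    through (x, a) at parameter \<open>r\<close>. The step depends on \<kappa> and \<epsilon> only,
    not on \<open>t\<close> or its \<open>p\<close>.\<close>
  define \<kappa> where "\<kappa> = R - a - r * \<beta>"
  define s where "s = r * (\<epsilon> / (\<bar>\<kappa>\<bar> + \<epsilon>))"
  have "\<epsilon> / (\<bar>\<kappa>\<bar> + \<epsilon>) > 0" "\<epsilon> / (\<bar>\<kappa>\<bar> + \<epsilon>) \<le> 1"
    using \<open>\<epsilon> > 0\<close> by auto
  then have s: "s > 0" "s \<le> r"
    unfolding s_def using r(1) by (intro mult_pos_pos mult_left_le; simp)+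
  have "h t (x + s *\<^sub>R v) \<le> ereal (a + s * \<beta>)" if t: "t \<in> T" for t
  proof -
    obtain p where p: "p \<ge> 0" "h t (x + p *\<^sub>R v) \<le> ereal (a - \<epsilon> + p * \<beta>)"
      using p[OF t] by blast
    show ?thesis
    \<comment> \<open>For \<open>s \<le> p\<close> one interpolates between \<open>0\<close> and
      \<open>p\<close>. Otherwise one interpolates between \<open>p\<close> and \<open>r\<close>,
      and the gain \<epsilon> at \<open>p\<close> must pay for the possible loss \<kappa> at
      \<open>r\<close>.\<close>
    proof (cases "s \<le> p")
      case True
      define \<theta> where "\<theta> = s / p"
      have \<theta>: "0 \<le> \<theta>" "\<theta> \<le> 1" "\<theta> * p = s"
        using True s(1) by (auto simp: \<theta>_def)
      have "h t (x + ((1 - \<theta>) * 0 + \<theta> * p) *\<^sub>R v) \<le> ereal ((1 - \<theta>) * a + \<theta> * (a - \<epsilon> + p * \<beta>))"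
        using h(2)[OF t] p(2) \<theta> by (intro convex_fun_line[OF h(1)[OF t]]) auto
      also have "(1 - \<theta>) * a + \<theta> * (a - \<epsilon> + p * \<beta>) = a + (\<theta> * p) * \<beta> - \<theta> * \<epsilon>"
        by (simp add: algebra_simps)
      finally have "h t (x + s *\<^sub>R v) \<le> ereal (a + s * \<beta> - \<theta> * \<epsilon>)"
        by (simp add: \<theta>(3))
      also have "\<dots> \<le> ereal (a + s * \<beta>)"
        using \<theta>(1) \<open>\<epsilon> > 0\<close> by simp
      finally show ?thesis .
    next
      case False
      define \<theta> where "\<theta> = (s - p) / (r - p)"
      have \<theta>: "0 \<le> \<theta>" "\<theta> \<le> 1" "\<theta> * (r - p) = s - p"
        using False s(2) p(1) by (auto simp: \<theta>_def)
      have "\<theta> \<le> s / r"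
        using False s p(1) r(1) mult_left_mono[OF s(2) p(1)] by (simp add: \<theta>_def field_simps)
      also have "s / r = \<epsilon> / (\<bar>\<kappa>\<bar> + \<epsilon>)"
        using r(1) by (simp add: s_def)
      finally have "\<theta> * (\<bar>\<kappa>\<bar> + \<epsilon>) \<le> \<epsilon>"
        using \<open>\<epsilon> > 0\<close> by (simp add: pos_le_divide_eq)
      moreover have "\<theta> * \<kappa> \<le> \<theta> * \<bar>\<kappa>\<bar>"
        using \<theta>(1) by (intro mult_left_mono) auto
      ultimately have "\<theta> * \<kappa> - (1 - \<theta>) * \<epsilon> \<le> 0"
        by (simp add: algebra_simps)
      moreover have eq: "(1 - \<theta>) * p + \<theta> * r = s"
        using \<theta>(3) by (simp add: algebra_simps)
      moreover have "(1 - \<theta>) * (a - \<epsilon> + p * \<beta>) + \<theta> * R =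
          a + ((1 - \<theta>) * p + \<theta> * r) * \<beta> + (\<theta> * \<kappa> - (1 - \<theta>) * \<epsilon>)"
        by (simp add: \<kappa>_def algebra_simps)
      ultimately have "(1 - \<theta>) * (a - \<epsilon> + p * \<beta>) + \<theta> * R \<le> a + s * \<beta>"
        by simp
      moreover have "h t (x + s *\<^sub>R v) \<le> ereal ((1 - \<theta>) * (a - \<epsilon> + p * \<beta>) + \<theta> * R)"
        using convex_fun_line[OF h(1)[OF t] p(2) r(2)[OF t] \<theta>(1,2)] by (simp add: eq)
      ultimately show ?thesis
        by (meson ereal_less_eq(3) order_trans)
    qed
  qed
  with s show ?thesis by blast
qed

section \<open>The subdifferential of the supremum\<close>

text \<open>A bound above on \<open>A + N\<close> forces the sign on \<open>N\<close>, because the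
  elements of \<open>N\<close> can be scaled up. For empty \<open>A\<close> the zero vector with
  level -1 satisfies everything.\<close>

lemma separate_from_plus_cone:
  fixes A N :: "'a::locally_convex_space dual set"
  assumes A: "convex A" and N: "convex N" "0 \<in> N" "\<And>c n. c \<ge> 0 \<Longrightarrow> n \<in> N \<Longrightarrow> c *\<^sub>R n \<in> N"
    and notin: "\<phi> \<notin> closure (A + N)"
  obtains v \<beta> where "\<And>\<alpha>. \<alpha> \<in> A \<Longrightarrow> dual_apply \<alpha> v \<le> \<beta>" "\<And>n. n \<in> N \<Longrightarrow> dual_apply n v \<le> 0"
    "\<beta> < dual_apply \<phi> v"
proof (cases "A = {}")
  case True
  then show thesis
    using that[of 0 "-1"] by (auto simp: dual_apply_linear_simps)
next
  case False
  then obtain \<alpha>\<^sub>0 where \<alpha>0: "\<alpha>\<^sub>0 \<in> A" by blast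
  have ne: "A + N \<noteq> {}"
    using set_plus_intro[OF \<alpha>0 N(2)] by blast
  obtain v \<beta> where v: "\<And>k. k \<in> A + N \<Longrightarrow> dual_apply k v \<le> \<beta>" "\<beta> < dual_apply \<phi> v"
    using weak_star_separation[OF convex_set_plus[OF A N(1)] ne notin] by metis
  show thesis
  proof (rule that[OF _ _ v(2)])
    show "dual_apply \<alpha> v \<le> \<beta>" if "\<alpha> \<in> A" for \<alpha>
      using v(1)[OF set_plus_intro[OF that N(2)]] by simp
    show "dual_apply n v \<le> 0" if n: "n \<in> N" for n
    proof (rule ccontr)
      assume pos: "\<not> dual_apply n v \<le> 0"
      define c where "c = (\<bar>\<beta> - dual_apply \<alpha>\<^sub>0 v\<bar> + 1) / dual_apply n v"
      have "c \<ge> 0"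
        unfolding c_def using pos by (intro divide_nonneg_nonneg) auto
      then have "dual_apply \<alpha>\<^sub>0 v + c * dual_apply n v \<le> \<beta>"
        using v(1)[OF set_plus_intro[OF \<alpha>0 N(3)[OF _ n]]] by (simp add: dual_rep_eqs)
      moreover have "c * dual_apply n v = \<bar>\<beta> - dual_apply \<alpha>\<^sub>0 v\<bar> + 1"
        using pos by (simp add: c_def)
      ultimately show False by linarith
    qed
  qed
qed

lemma normal_cone_convex_cone:
  assumes "x \<in> C"
  shows "convex (normal_cone C x)" "0 \<in> normal_cone C x"
    "\<And>c n. c \<ge> 0 \<Longrightarrow> n \<in> normal_cone C x \<Longrightarrow> c *\<^sub>R n \<in> normal_cone C x"
proof -
  show "convex (normal_cone C x)"
    unfolding convex_def using assms
    by (auto simp: normal_cone_eq dual_rep_eqs intro!: add_nonpos_nonpos mult_nonneg_nonpos)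
qed (use assms in \<open>auto simp: normal_cone_eq dual_rep_eqs intro: mult_nonneg_nonpos\<close>)

text \<open>This is the hard inclusion for convex lower semicontinuous functions. The affine
  minorant at \<open>y = x\<close> and the bound on \<open>h t x\<close> force \<open>a\<close> to
  be the supremum at \<open>x\<close>.\<close>

lemma subgradient_sup_mem_closure:
  fixes h :: "'i \<Rightarrow> 'a::locally_convex_space \<Rightarrow> ereal"
  assumes h: "\<And>t. t \<in> T \<Longrightarrow> convex_fun (h t)" "\<And>t. t \<in> T \<Longrightarrow> lsc_fun (h t)"
      "\<And>t. t \<in> T \<Longrightarrow> h t x \<le> ereal a"
    and D: "convex D" "x \<in> D" "\<And>y. y \<in> D \<Longrightarrow> (SUP t\<in>T. h t y) < \<infinity>"
      "\<And>y. y \<in> D \<Longrightarrow> ereal (a + dual_apply \<phi> (y - x)) \<le> (SUP t\<in>T. h t y)"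
    and L: "L \<in> fin_dim_affine_through x" and "\<epsilon> > 0"
  shows "\<phi> \<in> closure (convex hull (\<Union>t\<in>{t \<in> T. ereal (a - \<epsilon>) \<le> h t x}. eps_subdifferential \<epsilon> (h t) x)
    + normal_cone (D \<inter> L) x)"
proof (rule ccontr)
  define A where "A = (\<Union>t\<in>{t \<in> T. ereal (a - \<epsilon>) \<le> h t x}. eps_subdifferential \<epsilon> (h t) x)"
  assume notin: "\<not> ?thesis"
  obtain B where B: "affine L" "x \<in> L" "finite B" "L = affine hull B"
    using L by (auto simp: fin_dim_affine_through_def)
  have xDL: "x \<in> D \<inter> L" and conv: "convex (D \<inter> L)"
    using D(1,2) B(1,2) by (auto intro: convex_Int affine_imp_convex)
  have span: "y - x \<in> span B" if "y \<in> D \<inter> L" for y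
    using that B(2,4) affine_hull_subset_span[of B] by (blast intro: span_diff)
  obtain v \<beta> where v: "\<And>\<alpha>. \<alpha> \<in> convex hull A \<Longrightarrow> dual_apply \<alpha> v \<le> \<beta>"
    "\<And>n. n \<in> normal_cone (D \<inter> L) x \<Longrightarrow> dual_apply n v \<le> 0" "\<beta> < dual_apply \<phi> v"
    using separate_from_plus_cone[OF convex_convex_hull normal_cone_convex_cone[OF xDL] notin[folded A_def]]
    by metis
  obtain y\<^sub>0 where y0: "y\<^sub>0 \<in> D \<inter> L"
    "\<And>\<delta>. \<delta> > 0 \<Longrightarrow> \<exists>r>0. x + r *\<^sub>R (v + \<delta> *\<^sub>R (y\<^sub>0 - x)) \<in> D \<inter> L"
    using ex_feasible_perturbation[OF conv xDL B(3) span v(2)] by metis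
  have sup_real: "\<exists>R. (SUP t\<in>T. h t y) = ereal R" if "y \<in> D" for y
    using D(3,4)[OF that] by (cases "SUP t\<in>T. h t y") auto
  obtain R\<^sub>0 where R0: "(SUP t\<in>T. h t y\<^sub>0) = ereal R\<^sub>0"
    using sup_real y0(1) by blast
  have active_real: "\<exists>a'\<le>a. h t x = ereal a' \<and> a - \<epsilon> \<le> a'" if "t \<in> T" "ereal (a - \<epsilon>) \<le> h t x" for t
    using that(2) h(3)[OF that(1)] by (cases "h t x") auto
  \<comment> \<open>The value of the supremum at \<open>y\<^sub>0\<close> bounds all almost active
    subgradients uniformly in the direction \<open>y\<^sub>0 - x\<close>; this controls the cost of
    perturbing \<open>v\<close>.\<close>
  have bound: "dual_apply \<alpha> (y\<^sub>0 - x) \<le> R\<^sub>0 - a + 2 * \<epsilon>" if \<alpha>: "\<alpha> \<in> A" for \<alpha>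
  proof -
    obtain t where t: "t \<in> T" "ereal (a - \<epsilon>) \<le> h t x" "\<alpha> \<in> eps_subdifferential \<epsilon> (h t) x"
      using \<alpha> unfolding A_def by blast
    obtain a' where a': "h t x = ereal a'" "a - \<epsilon> \<le> a'"
      using active_real[OF t(1,2)] by blast
    have "h t y\<^sub>0 \<le> ereal R\<^sub>0"
      using t(1) unfolding R0[symmetric] by (rule SUP_upper)
    moreover have "ereal (dual_apply \<alpha> (y\<^sub>0 - x)) \<le> h t y\<^sub>0 - h t x + ereal \<epsilon>"
      using t(3) by (auto simp: eps_subdifferential_def split: if_splits)
    ultimately show ?thesis
      using a' by (cases "h t y\<^sub>0") auto
  qed
  define M where "M = R\<^sub>0 - a + 2 * \<epsilon>"
  \<comment> \<open>Chosen so small that the strict gap between \<beta> and the value of \<phi>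
    survives the passage from \<open>v\<close> to \<open>w\<close>; the 1 avoids a zero
    denominator.\<close>
  define \<delta> where "\<delta> = (dual_apply \<phi> v - \<beta>) / (\<bar>M - dual_apply \<phi> (y\<^sub>0 - x)\<bar> + 1)"
  have "\<delta> > 0"
    unfolding \<delta>_def using v(3) by (intro divide_pos_pos) auto
  define w where "w = v + \<delta> *\<^sub>R (y\<^sub>0 - x)"
  have "\<delta> * (M - dual_apply \<phi> (y\<^sub>0 - x)) < \<delta> * (\<bar>M - dual_apply \<phi> (y\<^sub>0 - x)\<bar> + 1)"
    using \<open>\<delta> > 0\<close> by (intro mult_strict_left_mono) auto
  also have "\<dots> = dual_apply \<phi> v - \<beta>"
    by (simp add: \<delta>_def)
  finally have "\<beta> + \<delta> * M < dual_apply \<phi> w"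
    by (simp add: w_def dual_apply_linear_simps right_diff_distrib)
  then obtain \<beta>' where \<beta>': "\<beta> + \<delta> * M < \<beta>'" "\<beta>' < dual_apply \<phi> w"
    using dense by blast
  have A_le: "dual_apply \<alpha> w \<le> \<beta> + \<delta> * M" if "\<alpha> \<in> A" for \<alpha>
  proof -
    have "dual_apply \<alpha> v \<le> \<beta>"
      using v(1) hull_inc[OF that] by blast
    moreover have "\<delta> * dual_apply \<alpha> (y\<^sub>0 - x) \<le> \<delta> * M"
      using bound[OF that] \<open>\<delta> > 0\<close> by (intro mult_left_mono) (auto simp: M_def)
    ultimately show ?thesis
      by (simp add: w_def dual_apply_linear_simps)
  qed
  obtain r where r: "r > 0" "x + r *\<^sub>R w \<in> D"
    using y0(2)[OF \<open>\<delta> > 0\<close>] by (auto simp: w_def)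
  obtain R where R: "(SUP t\<in>T. h t (x + r *\<^sub>R w)) = ereal R"
    using sup_real[OF r(2)] by blast
  \<comment> \<open>An almost active \<open>h t\<close> that stayed above this line would have an
    \<epsilon>-subgradient in \<open>A\<close> violating \<open>A_le\<close>. The other functions
    already lie below the line at \<open>p = 0\<close>.\<close>
  have "\<exists>p\<ge>0. h t (x + p *\<^sub>R w) \<le> ereal (a - \<epsilon> + p * \<beta>')" if t: "t \<in> T" for t
  proof (cases "ereal (a - \<epsilon>) \<le> h t x")
    case True
    obtain a' where a': "a' \<le> a" "h t x = ereal a'"
      using active_real[OF t True] by blast
    have "\<exists>p>0. h t (x + p *\<^sub>R w) \<le> ereal (a' - \<epsilon> + p * \<beta>')"
    proof (rule ccontr)
      assume "\<not> ?thesis"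
      then have "ereal (a' - \<epsilon> + p * \<beta>') < h t (x + p *\<^sub>R w)" if "p > 0" for p
        using that not_le by blast
      from ex_eps_subgradient[OF h(1,2)[OF t] a'(2) \<open>\<epsilon> > 0\<close> this \<beta>'(1)]
      obtain \<alpha> where "\<alpha> \<in> eps_subdifferential \<epsilon> (h t) x" "\<beta> + \<delta> * M < dual_apply \<alpha> w"
        by blast
      moreover from this have "\<alpha> \<in> A"
        using t True by (auto simp: A_def)
      ultimately show False
        using A_le by fastforce
    qed
    then obtain p where p: "p > 0" "h t (x + p *\<^sub>R w) \<le> ereal (a' - \<epsilon> + p * \<beta>')"
      by blast
    note p(2)
    also have "ereal (a' - \<epsilon> + p * \<beta>') \<le> ereal (a - \<epsilon> + p * \<beta>')"
      using a'(1) by simp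
    finally show ?thesis
      using p(1) by (intro exI[of _ p]) simp
  next
    case False
    then show ?thesis
      by (intro exI[of _ 0]) auto
  qed
  moreover have "h t (x + r *\<^sub>R w) \<le> ereal R" if "t \<in> T" for t
    using that unfolding R[symmetric] by (rule SUP_upper)
  ultimately obtain s where s: "s > 0" "s \<le> r" "\<forall>t\<in>T. h t (x + s *\<^sub>R w) \<le> ereal (a + s * \<beta>')"
    using ex_uniform_step[of T h x a r w R \<epsilon> \<beta>'] h(1,3) r(1) \<open>\<epsilon> > 0\<close> by metis
  have "x + s *\<^sub>R w = (1 - s / r) *\<^sub>R x + (s / r) *\<^sub>R (x + r *\<^sub>R w)"
    using r(1) by (simp add: algebra_simps)
  also have "\<dots> \<in> D"
    using s(1,2) r by (intro convexD[OF D(1,2)]) auto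
  finally have "ereal (a + dual_apply \<phi> (x + s *\<^sub>R w - x)) \<le> (SUP t\<in>T. h t (x + s *\<^sub>R w))"
    by (rule D(4))
  also have "\<dots> \<le> ereal (a + s * \<beta>')"
    using s(3) by (intro SUP_least) auto
  finally show False
    using s(1) \<beta>'(2) by (simp add: dual_apply_linear_simps)
qed

section \<open>From the intersection to the subdifferential\<close>

lemma mem_closure_dual_approx:
  assumes "\<phi> \<in> closure K" "e > 0"
  shows "\<exists>k\<in>K. dual_apply \<phi> v < dual_apply k v + e"
proof -
  define V where "V = {g :: 'a \<Rightarrow> real. dual_apply \<phi> v < g v + e}"
  have "open V"
    unfolding V_def by (intro open_Collect_less continuous_intros continuous_on_product_coordinates)
  then have "open (dual_apply -` V)"
    by (auto simp: open_dual_def)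
  moreover have "\<phi> \<in> dual_apply -` V"
    using assms(2) by (simp add: V_def)
  ultimately have "dual_apply -` V \<inter> K \<noteq> {}"
    using assms(1) unfolding closure_iff_nhds_not_empty by blast
  then show ?thesis
    by (auto simp: V_def)
qed

text \<open>One \<epsilon> is lost to the activity of \<open>t\<close> and one to the approximate
  subgradient.\<close>

lemma eps_subdifferential_activeD:
  assumes t: "t \<in> eps_active T f \<epsilon> x" and \<alpha>: "\<alpha> \<in> eps_subdifferential \<epsilon> (f t) x"
    and fx: "sup_fun T f x = ereal a"
  shows "ereal (a + dual_apply \<alpha> (y - x) - 2 * \<epsilon>) \<le> sup_fun T f y"
proof -
  have tT: "t \<in> T" and act: "ereal a \<le> f t x + ereal \<epsilon>"
    using t fx by (auto simp: eps_active_def)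
  obtain b where b: "f t x = ereal b"
    using \<alpha> by (cases "f t x") (auto simp: eps_subdifferential_def)
  have "ereal (dual_apply \<alpha> (y - x)) \<le> f t y - f t x + ereal \<epsilon>"
    using \<alpha> by (auto simp: eps_subdifferential_def split: if_splits)
  then have "ereal (a + dual_apply \<alpha> (y - x) - 2 * \<epsilon>) \<le> f t y"
    using act b by (cases "f t y") auto
  also have "\<dots> \<le> sup_fun T f y"
    unfolding sup_fun_def using tT by (rule SUP_upper)
  finally show ?thesis .
qed

lemma mem_subdifferential_indicator_sumI:
  fixes f :: "'i \<Rightarrow> 'a::locally_convex_space \<Rightarrow> ereal"
  assumes \<phi>: "\<And>\<epsilon> L. \<epsilon> > 0 \<Longrightarrow> L \<in> fin_dim_affine_through x \<Longrightarrow>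
    \<phi> \<in> closure (convex hull (\<Union>t\<in>eps_active T f \<epsilon> x. eps_subdifferential \<epsilon> (f t) x)
               + normal_cone (D \<inter> L) x)"
  shows "\<phi> \<in> subdifferential (\<lambda>y. sup_fun T f y + indicator_fun D y) x"
proof -
  define A where "A \<epsilon> = (\<Union>t\<in>eps_active T f \<epsilon> x. eps_subdifferential \<epsilon> (f t) x)" for \<epsilon>
  have approx: "\<exists>\<alpha>\<in>convex hull A \<epsilon>. \<exists>n\<in>normal_cone (D \<inter> L) x.
      dual_apply \<phi> v < dual_apply \<alpha> v + dual_apply n v + \<epsilon>"
    if "\<epsilon> > 0" "L \<in> fin_dim_affine_through x" for \<epsilon> L v
    using mem_closure_dual_approx[OF \<phi>[OF that] that(1), of v]
    by (auto simp: A_def dual_rep_eqs elim!: set_plus_elim) (metis plus_dual.rep_eq)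
  have L_x: "affine hull {x, y} \<in> fin_dim_affine_through x" for y
    unfolding fin_dim_affine_through_def
    by (auto simp: affine_affine_hull hull_inc intro!: exI[of _ "{x, y}"])
  \<comment> \<open>The case \<epsilon> = 1 with the one-point subspace already shows that
    \<open>x\<close> is in \<open>D\<close> and that the supremum at \<open>x\<close> is finite,
    since some active \<open>f t\<close> is finite there.\<close>
  obtain \<alpha> n where "\<alpha> \<in> convex hull A 1" "n \<in> normal_cone (D \<inter> affine hull {x, x}) x"
    using approx[OF zero_less_one L_x[of x]] by blast
  then have "A 1 \<noteq> {}" and xD: "x \<in> D"
    by (auto simp: normal_cone_eq split: if_splits)
  then obtain \<alpha> t where t: "t \<in> eps_active T f 1 x" "\<alpha> \<in> eps_subdifferential 1 (f t) x"
    by (auto simp: A_def)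
  then obtain b where b: "f t x = ereal b" "t \<in> T" "sup_fun T f x \<le> ereal (b + 1)"
    by (cases "f t x") (auto simp: eps_subdifferential_def eps_active_def)
  moreover have "f t x \<le> sup_fun T f x"
    unfolding sup_fun_def using b(2) by (rule SUP_upper)
  ultimately obtain a where a: "sup_fun T f x = ereal a"
    by (cases "sup_fun T f x") auto
  have *: "ereal (a + dual_apply \<phi> (y - x)) \<le> sup_fun T f y" if y: "y \<in> D" for y
  proof (rule ereal_le_epsilon2)
    fix e :: real assume "e > 0"
    \<comment> \<open>Two of the three shares go to \<open>eps_subdifferential_activeD\<close>, one
      to the weak* approximation.\<close>
    define \<epsilon> where "\<epsilon> = e / 3"
    have "\<epsilon> > 0"
      using \<open>e > 0\<close> by (simp add: \<epsilon>_def)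
    obtain \<alpha> n where \<alpha>: "\<alpha> \<in> convex hull A \<epsilon>" and n: "n \<in> normal_cone (D \<inter> affine hull {x, y}) x"
      and less: "dual_apply \<phi> (y - x) < dual_apply \<alpha> (y - x) + dual_apply n (y - x) + \<epsilon>"
      using approx[OF \<open>\<epsilon> > 0\<close> L_x[of y]] by blast
    have "dual_apply n (y - x) \<le> 0"
      using n y by (auto simp: normal_cone_eq hull_inc split: if_splits)
    show "ereal (a + dual_apply \<phi> (y - x)) \<le> sup_fun T f y + ereal e"
    proof (cases "sup_fun T f y")
      case PInf
      then show ?thesis by simp
    next
      case MInf
      have "A \<epsilon> \<noteq> {}"
        using \<alpha> by auto
      then show ?thesis
        using eps_subdifferential_activeD[OF _ _ a, of _ \<epsilon> _ y] MInf by (auto simp: A_def)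
    next
      case (real c)
      \<comment> \<open>The bound is a half-space of the dual, so it passes from the single
        subgradients to their convex hull.\<close>
      have "A \<epsilon> \<subseteq> {\<alpha>. dual_apply \<alpha> (y - x) \<le> c - a + 2 * \<epsilon>}"
        using eps_subdifferential_activeD[OF _ _ a, of _ \<epsilon> _ y] real by (force simp: A_def)
      moreover have "convex {\<alpha>. dual_apply \<alpha> (y - x) \<le> c - a + 2 * \<epsilon>}"
      proof -
        have "convex ((\<lambda>\<alpha>. dual_apply \<alpha> (y - x)) -` {..c - a + 2 * \<epsilon>})"
          by (intro convex_linear_vimage linear_evaluation) auto
        then show ?thesis
          by (simp add: vimage_def)
      qed
      ultimately have "convex hull A \<epsilon> \<subseteq> {\<alpha>. dual_apply \<alpha> (y - x) \<le> c - a + 2 * \<epsilon>}"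
        by (rule hull_minimal)
      then show ?thesis
        using \<alpha> less \<open>dual_apply n (y - x) \<le> 0\<close> real by (auto simp: \<epsilon>_def)
    qed
  qed
  have "ereal (dual_apply \<phi> (y - x)) \<le> sup_fun T f y + indicator_fun D y - ereal a" for y
  proof (cases "y \<in> D")
    case True
    then show ?thesis
      using *[OF True] by (cases "sup_fun T f y") (auto simp: indicator_fun_def)
  qed (simp add: indicator_fun_def)
  then show ?thesis
    using xD a by (simp add: eps_subdifferential_def indicator_fun_def zero_ereal_def[symmetric])
qed

section \<open>Transfer from the envelopes to the original family\<close>

theorem theorem5p4:
  fixes f :: "'i \<Rightarrow> 'a::locally_convex_space \<Rightarrow> ereal"
    and T :: "'i set" and D :: "'a set"
  assumes "T \<noteq> {}"
    and "convex D"
    and "D \<subseteq> effective_dom (convex_lsc_envelope (sup_fun T f))"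
    and "\<forall>x\<in>D. convex_lsc_envelope (\<lambda>y. sup_fun T f y + indicator_fun D y) x
           = (SUP t\<in>T. convex_lsc_envelope (f t) x)"
  shows "\<forall>x::'a. subdifferential (\<lambda>y. sup_fun T f y + indicator_fun D y) x =
    (\<Inter>\<epsilon>\<in>{0<..}. \<Inter>L\<in>fin_dim_affine_through x.
      closure (convex hull (\<Union>t\<in>eps_active T f \<epsilon> x. eps_subdifferential \<epsilon> (f t) x)
               + normal_cone (D \<inter> L) x))"
proof (intro allI subset_antisym subsetI)
  fix x :: 'a and \<phi>
  assume "\<phi> \<in> (\<Inter>\<epsilon>\<in>{0<..}. \<Inter>L\<in>fin_dim_affine_through x.
      closure (convex hull (\<Union>t\<in>eps_active T f \<epsilon> x. eps_subdifferential \<epsilon> (f t) x)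
               + normal_cone (D \<inter> L) x))"
  then show "\<phi> \<in> subdifferential (\<lambda>y. sup_fun T f y + indicator_fun D y) x"
    by (intro mem_subdifferential_indicator_sumI) auto
next
  fix x :: 'a and \<phi>
  define g where "g = (\<lambda>y. sup_fun T f y + indicator_fun D y)"
  define h where "h t = convex_lsc_envelope (f t)" for t
  assume \<phi>: "\<phi> \<in> subdifferential (\<lambda>y. sup_fun T f y + indicator_fun D y) x"
  then have "\<bar>g x\<bar> \<noteq> \<infinity>"
    by (auto simp: g_def eps_subdifferential_def)
  then have xD: "x \<in> D"
    by (auto simp: g_def indicator_fun_def split: if_splits)
  with \<open>\<bar>g x\<bar> \<noteq> \<infinity>\<close> obtain a where a: "sup_fun T f x = ereal a" "g x = ereal a"
    by (cases "sup_fun T f x") (auto simp: g_def indicator_fun_def)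
  have "(\<lambda>y. ereal (a + dual_apply \<phi> (y - x))) \<le> g"
  proof (rule le_funI)
    fix y
    have "ereal (dual_apply \<phi> (y - x)) \<le> g y - g x + ereal 0"
      using \<phi> unfolding g_def by (auto simp: eps_subdifferential_def split: if_splits)
    then show "ereal (a + dual_apply \<phi> (y - x)) \<le> g y"
      using a(2) by (cases "g y") auto
  qed
  \<comment> \<open>The affine minorant of \<open>g\<close> competes in the envelope of
    \<open>g\<close>, which on \<open>D\<close> equals the supremum of the envelopes.\<close>
  then have minorant: "ereal (a + dual_apply \<phi> (y - x)) \<le> (SUP t\<in>T. h t y)" if "y \<in> D" for y
    using convex_lsc_envelope_greatest[OF convex_fun_affine lsc_fun_affine, of a \<phi> x g y]
      assms(4) that unfolding g_def h_def by simp
  have h_le: "h t y \<le> sup_fun T f y" if "t \<in> T" for t y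
  proof -
    have "h t y \<le> f t y"
      unfolding h_def by (rule convex_lsc_envelope_le)
    also have "\<dots> \<le> sup_fun T f y"
      unfolding sup_fun_def using that by (rule SUP_upper)
    finally show ?thesis .
  qed
  have finite_sup: "(SUP t\<in>T. h t y) < \<infinity>" if "y \<in> D" for y
  proof -
    have "h t y \<le> convex_lsc_envelope (sup_fun T f) y" if "t \<in> T" for t
      using h_le[OF that]
      by (intro convex_lsc_envelope_greatest)
        (auto simp: h_def le_fun_def convex_fun_convex_lsc_envelope lsc_fun_convex_lsc_envelope)
    then have "(SUP t\<in>T. h t y) \<le> convex_lsc_envelope (sup_fun T f) y"
      by (rule SUP_least)
    also have "\<dots> < \<infinity>"
      using assms(3) that by (auto simp: effective_dom_def)
    finally show ?thesis .
  qed
  show "\<phi> \<in> (\<Inter>\<epsilon>\<in>{0<..}. \<Inter>L\<in>fin_dim_affine_through x.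
      closure (convex hull (\<Union>t\<in>eps_active T f \<epsilon> x. eps_subdifferential \<epsilon> (f t) x)
               + normal_cone (D \<inter> L) x))"
  proof (intro INT_I)
    fix \<epsilon> :: real and L assume "\<epsilon> \<in> {0<..}" and L: "L \<in> fin_dim_affine_through x"
    \<comment> \<open>If \<open>h t x\<close> is at least \<open>a - \<eta>\<close>, it is within
      \<eta> of \<open>f t x\<close>. Hence an \<eta>-subgradient of \<open>h t\<close> is a
      2\<eta>-subgradient of \<open>f t\<close>.\<close>
    define \<eta> where "\<eta> = \<epsilon> / 2"
    have "\<eta> > 0" "\<epsilon> = 2 * \<eta>"
      using \<open>\<epsilon> \<in> {0<..}\<close> by (auto simp: \<eta>_def)
    define A where "A = (\<Union>t\<in>{t \<in> T. ereal (a - \<eta>) \<le> h t x}. eps_subdifferential \<eta> (h t) x)"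
    have "A \<subseteq> (\<Union>t\<in>eps_active T f \<epsilon> x. eps_subdifferential \<epsilon> (f t) x)"
    proof
      fix \<alpha> assume "\<alpha> \<in> A"
      then obtain t where t: "t \<in> T" "ereal (a - \<eta>) \<le> h t x" "\<alpha> \<in> eps_subdifferential \<eta> (h t) x"
        by (auto simp: A_def)
      have f_le: "f t x \<le> ereal a"
        using t(1) unfolding a(1)[symmetric] sup_fun_def by (rule SUP_upper)
      have hf: "h t y \<le> f t y" for y
        unfolding h_def by (rule convex_lsc_envelope_le)
      obtain b c where bc: "h t x = ereal b" "f t x = ereal c" "a - \<eta> \<le> b" "b \<le> c" "c \<le> a"
        using t(2) f_le hf[of x] by (cases "h t x"; cases "f t x") auto
      have "t \<in> eps_active T f \<epsilon> x"
        using t(1) a(1) bc \<open>\<eta> > 0\<close> by (simp add: eps_active_def \<open>\<epsilon> = 2 * \<eta>\<close>)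
      moreover have "ereal (dual_apply \<alpha> (y - x)) \<le> f t y - f t x + ereal \<epsilon>" for y
      proof -
        have "ereal (dual_apply \<alpha> (y - x)) \<le> h t y - h t x + ereal \<eta>"
          using t(3) by (auto simp: eps_subdifferential_def split: if_splits)
        then show ?thesis
          using hf[of y] bc by (cases "h t y"; cases "f t y") (auto simp: \<open>\<epsilon> = 2 * \<eta>\<close>)
      qed
      then have "\<alpha> \<in> eps_subdifferential \<epsilon> (f t) x"
        using bc(2) by (simp add: eps_subdifferential_def)
      ultimately show "\<alpha> \<in> (\<Union>t\<in>eps_active T f \<epsilon> x. eps_subdifferential \<epsilon> (f t) x)"
        by blast
    qed
    then have "closure (convex hull A + normal_cone (D \<inter> L) x) \<subseteq>
        closure (convex hull (\<Union>t\<in>eps_active T f \<epsilon> x. eps_subdifferential \<epsilon> (f t) x)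
               + normal_cone (D \<inter> L) x)"
      by (intro closure_mono set_plus_mono2 hull_mono order_refl)
    moreover have "\<phi> \<in> closure (convex hull A + normal_cone (D \<inter> L) x)"
      unfolding A_def
    proof (rule subgradient_sup_mem_closure[OF _ _ _ assms(2) xD finite_sup minorant L \<open>\<eta> > 0\<close>])
      show "h t x \<le> ereal a" if "t \<in> T" for t
        using h_le[OF that, of x] a(1) by simp
    qed (simp_all add: h_def convex_fun_convex_lsc_envelope lsc_fun_convex_lsc_envelope)
    ultimately show "\<phi> \<in> closure (convex hull (\<Union>t\<in>eps_active T f \<epsilon> x. eps_subdifferential \<epsilon> (f t) x)
               + normal_cone (D \<inter> L) x)"
      by blast
  qed
qed

end
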